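(* Let $\Bbbk$ be an algebraically closed field of characteristic zero, and let $\mathbf f,\mathbf g\in\Bbbk[x,y]$ be two nonzero polynomials. (1) Suppose there are $c_1,c_2\in\Bbbk$ and $\begin{pmatrix}c_{11}&c_{12}\\c_{21}&c_{22}\end{pmatrix}\in GL_2(\Bbbk)$ such that $$\mathbf g=\frac{\mathbf f(c_{11}x+c_{12}y+c_1,\;c_{21}x+c_{22}y+c_2)}{c_{11}c_{22}-c_{12}c_{21}}.\qquad( * )$$ Then $K\{\mathbf f\}\cong K\{\mathbf g\}$ as Poisson fields. (2) Assume that $\mathbf f$ and $\mathbf g$ are products of distinct linear forms and both satisfy the condition (G) defined in the context. If $K\{\mathbf f\}\cong K\{\mathbf g\}$, then there exist $c_1,c_2\in\Bbbk$ and $\begin{pmatrix}c_{11}&c_{12}\\c_{21}&c_{22}\end{pmatrix}\in GL_2(\Bbbk)$ such that $( * )$ holds. (3) Assume that $\mathbf f$ and $\mathbf g$ are each products of $4$ or more homogeneous linear forms that are distinct up to scalars. Then $K\{\mathbf f\}\cong K\{\mathbf g\}$ if and only if there is some $\begin{pmatrix}c_{11}&c_{12}\\c_{21}&c_{22}\end{pmatrix}\in GL_2(\Bbbk)$ such that $$\mathbf g=\frac{\mathbf f(c_{11}x+c_{12}y,\;c_{21}x+c_{22}y)}{c_{11}c_{22}-c_{12}c_{21}}.$$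
   Context: For $\mathbf f\in\Bbbk(x,y)$, $K\{\mathbf f\}$ denotes the rational function field $\Bbbk(x,y)$ equipped with the unique ($\Bbbk$-bilinear) Poisson bracket such that $\{x,y\}=\mathbf f$; explicitly $\{g,h\}=\left(\frac{\partial g}{\partial x}\frac{\partial h}{\partial y}-\frac{\partial g}{\partial y}\frac{\partial h}{\partial x}\right)\mathbf f$. Isomorphisms of Poisson fields are $\Bbbk$-algebra isomorphisms preserving the Poisson brackets. A polynomial $\mathbf f\in\Bbbk[x,y]$ is a product of distinct linear forms if $\mathbf f=\prod_{i=1}^n l_i$ with $l_i=a_ix+b_iy+c_i\notin\Bbbk$ ($a_i,b_i,c_i\in\Bbbk$; constant terms are allowed) and $l_i\notin\Bbbk^\times l_j$ for all $i\ne j$. Such an $\mathbf f$ satisfies condition (G) if for each $i$ there are at least three indices $j$ such that $l_i$ and $l_j$ generate the algebra $\Bbbk[x,y]$. *)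

theory Defs
  imports
    "HOL-Analysis.Determinants"
    "HOL-Computational_Algebra.Polynomial"
    "HOL-Computational_Algebra.Fraction_Field"
begin

section \<open>The polynomial ring \<open>k[x,y]\<close>\<close>

text \<open>
  The ring \<open>k[x,y]\<close> is represented as \<open>k[x][y]\<close>, that is, by the type \<open>'a poly poly\<close>:
  the inner variable is \<open>x\<close>, the outer one is \<open>y\<close>.
\<close>

type_synonym 'a bpoly = "'a poly poly"

definition scal :: "'a::comm_ring_1 \<Rightarrow> 'a bpoly" where
  "scal c = [:[:c:]:]"

definition varX :: "'a::comm_ring_1 bpoly" where
  "varX = [:[:0, 1:]:]"

definition varY :: "'a::comm_ring_1 bpoly" where
  "varY = [:0, 1:]"

definition affine_poly :: "'a::comm_ring_1 \<Rightarrow> 'a \<Rightarrow> 'a \<Rightarrow> 'a bpoly" where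
  "affine_poly a b c = scal a * varX + scal b * varY + scal c"

text \<open>The substitution \<open>f(p,q)\<close> of polynomials for \<open>x\<close> and \<open>y\<close>.\<close>

definition subst2 :: "'a::comm_ring_1 bpoly \<Rightarrow> 'a bpoly \<Rightarrow> 'a bpoly \<Rightarrow> 'a bpoly" where
  "subst2 f p q = poly (map_poly (\<lambda>r. poly (map_poly scal r) p) f) q"

definition is_subalgebra :: "'a::comm_ring_1 bpoly set \<Rightarrow> bool" where
  "is_subalgebra V \<longleftrightarrow>
     (\<forall>c. scal c \<in> V) \<and> (\<forall>p\<in>V. \<forall>q\<in>V. p + q \<in> V) \<and> (\<forall>p\<in>V. \<forall>q\<in>V. p * q \<in> V)"

definition generates_algebra :: "'a::comm_ring_1 bpoly set \<Rightarrow> bool" where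
  "generates_algebra S \<longleftrightarrow> is_subalgebra hull S = UNIV"


section \<open>Partial derivatives on \<open>k(x,y)\<close>\<close>

definition poly_dx :: "'a::idom bpoly \<Rightarrow> 'a bpoly" where
  "poly_dx p = map_poly pderiv p"

definition poly_dy :: "'a::idom bpoly \<Rightarrow> 'a bpoly" where
  "poly_dy p = pderiv p"

lemma coeff_poly_dx: "coeff (poly_dx p) i = pderiv (coeff p i)"
  by (simp add: poly_dx_def coeff_map_poly)

lemma poly_dx_mult: "poly_dx (p * q) = p * poly_dx q + q * poly_dx p"
proof (rule poly_eqI)
  fix n
  have pderiv_sum': "pderiv (sum h A) = (\<Sum>i\<in>A. pderiv (h i))"
    for h :: "nat \<Rightarrow> 'a poly" and A
    by (induction A rule: infinite_finite_induct) (auto simp: pderiv_add)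
  have "coeff (poly_dx (p * q)) n =
      (\<Sum>i\<le>n. coeff p i * pderiv (coeff q (n - i))) + (\<Sum>i\<le>n. coeff q (n - i) * pderiv (coeff p i))"
    by (simp add: coeff_poly_dx coeff_mult pderiv_sum' pderiv_mult sum.distrib)
  also have "(\<Sum>i\<le>n. coeff q (n - i) * pderiv (coeff p i)) = coeff (poly_dx p * q) n"
    unfolding coeff_mult coeff_poly_dx by (simp add: mult.commute)
  finally show "coeff (poly_dx (p * q)) n = coeff (p * poly_dx q + q * poly_dx p) n"
    unfolding mult.commute[of q "poly_dx p"] by (simp add: coeff_mult coeff_poly_dx)
qed

lemma poly_dy_mult: "poly_dy (p * q) = p * poly_dy q + q * poly_dy p"
  by (simp add: poly_dy_def pderiv_mult)

lemma quotient_rule_well_defined: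
  fixes a b a' b' da db da' db' :: "'r::comm_ring_1"
  assumes e: "a * b' = a' * b"
    and d: "a * db' + b' * da = a' * db + b * da'"
  shows "(da * b - a * db) * (b' * b') = (da' * b' - a' * db') * (b * b)"
proof -
  have "(da * b - a * db) * (b' * b') = b * b' * (b' * da + a * db') - b * b' * (a * db') - (a * b') * b' * db"
    by (simp add: algebra_simps)
  also have "\<dots> = b * b' * (a' * db + b * da') - b * (a * b') * db' - (a * b') * b' * db"
    using d by (simp add: algebra_simps)
  also have "\<dots> = (da' * b' - a' * db') * (b * b)"
    unfolding e by (simp add: algebra_simps)
  finally show ?thesis .
qed

text \<open>
  The extension of a derivation \<open>d\<close> to the fraction field by the quotient rule. It is independent of
  the chosen representative \<open>a/b\<close>, see \<open>fract_deriv_Fract\<close> below.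
\<close>

definition fract_deriv :: "('r::idom \<Rightarrow> 'r) \<Rightarrow> 'r fract \<Rightarrow> 'r fract" where
  "fract_deriv d q =
     (let (a, b) = (SOME (a, b). b \<noteq> 0 \<and> q = Fraction_Field.Fract a b)
      in Fraction_Field.Fract (d a * b - a * d b) (b * b))"

lemma fract_deriv_Fract:
  assumes d: "\<And>p q. d (p * q) = p * d q + q * d p" and b: "b \<noteq> 0"
  shows "fract_deriv d (Fraction_Field.Fract a b) =
    Fraction_Field.Fract (d a * b - a * d b) (b * b)"
proof -
  obtain a' b' where ab':
    "(SOME (a', b'). b' \<noteq> 0 \<and> Fraction_Field.Fract a b = Fraction_Field.Fract a' b') = (a', b')"
    by (rule prod.exhaust)
  have "case (a', b') of (a', b') \<Rightarrow>
      b' \<noteq> 0 \<and> Fraction_Field.Fract a b = Fraction_Field.Fract a' b'"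
    unfolding ab'[symmetric] by (rule someI[of _ "(a, b)"]) (use b in simp)
  hence b': "b' \<noteq> 0" and e: "a' * b = a * b'"
    using b by (auto simp: eq_fract)
  have "(d a' * b' - a' * d b') * (b * b) = (d a * b - a * d b) * (b' * b')"
  proof (rule quotient_rule_well_defined[OF e])
    show "a' * d b + b * d a' = a * d b' + b' * d a"
      using arg_cong[OF e, of d] unfolding d .
  qed
  thus ?thesis
    using b b' by (simp add: fract_deriv_def ab' eq_fract)
qed

definition dx :: "'a::idom bpoly fract \<Rightarrow> 'a bpoly fract" where
  "dx = fract_deriv poly_dx"

definition dy :: "'a::idom bpoly fract \<Rightarrow> 'a bpoly fract" where
  "dy = fract_deriv poly_dy"

lemma dx_Fract:
  "b \<noteq> 0 \<Longrightarrow> dx (Fraction_Field.Fract a b) =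
     Fraction_Field.Fract (poly_dx a * b - a * poly_dx b) (b * b)"
  unfolding dx_def by (rule fract_deriv_Fract[OF poly_dx_mult])

lemma dy_Fract:
  "b \<noteq> 0 \<Longrightarrow> dy (Fraction_Field.Fract a b) =
     Fraction_Field.Fract (poly_dy a * b - a * poly_dy b) (b * b)"
  unfolding dy_def by (rule fract_deriv_Fract[OF poly_dy_mult])


section \<open>The Poisson field \<open>K{f}\<close>\<close>

definition rat :: "'a::idom bpoly \<Rightarrow> 'a bpoly fract" where
  "rat p = Fraction_Field.Fract p 1"

definition poisson_bracket ::
  "'a::idom bpoly fract \<Rightarrow> 'a bpoly fract \<Rightarrow> 'a bpoly fract \<Rightarrow> 'a bpoly fract" where
  "poisson_bracket f g h = (dx g * dy h - dy g * dx h) * f"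

lemma poisson_bracket_xy:
  fixes f :: "'a::idom bpoly fract"
  shows "poisson_bracket f (rat varX) (rat varY) = f"
proof -
  have "poly_dx 1 = (0 :: 'a bpoly)"
    by (simp add: poly_dx_def one_pCons map_poly_pCons pderiv_pCons)
  moreover have "poly_dy 1 = (0 :: 'a bpoly)"
    by (simp add: poly_dy_def)
  moreover have "poly_dx varX = (1 :: 'a bpoly)" "poly_dx varY = (0 :: 'a bpoly)"
      "poly_dy varX = (0 :: 'a bpoly)" "poly_dy varY = (1 :: 'a bpoly)"
    by (simp_all add: poly_dx_def poly_dy_def varX_def varY_def map_poly_pCons pderiv_pCons
        one_pCons)
  ultimately show ?thesis
    by (simp add: poisson_bracket_def rat_def dx_Fract dy_Fract fract_collapse)
qed

definition poisson_field_iso ::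
  "'a::idom bpoly fract \<Rightarrow> 'a bpoly fract \<Rightarrow> ('a bpoly fract \<Rightarrow> 'a bpoly fract) \<Rightarrow> bool" where
  "poisson_field_iso f g \<phi> \<longleftrightarrow>
     bij \<phi> \<and>
     (\<forall>u v. \<phi> (u + v) = \<phi> u + \<phi> v) \<and>
     (\<forall>u v. \<phi> (u * v) = \<phi> u * \<phi> v) \<and>
     (\<forall>c. \<phi> (rat (scal c)) = rat (scal c)) \<and>
     (\<forall>u v. \<phi> (poisson_bracket f u v) = poisson_bracket g (\<phi> u) (\<phi> v))"

definition poisson_isomorphic :: "'a::idom bpoly fract \<Rightarrow> 'a bpoly fract \<Rightarrow> bool" where
  "poisson_isomorphic f g \<longleftrightarrow> (\<exists>\<phi>. poisson_field_iso f g \<phi>)"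


section \<open>Products of distinct linear forms\<close>

definition linear_form :: "'a::idom bpoly \<Rightarrow> bool" where
  "linear_form l \<longleftrightarrow> (\<exists>a b c. l = affine_poly a b c) \<and> l \<notin> range scal"

definition homogeneous_linear_form :: "'a::idom bpoly \<Rightarrow> bool" where
  "homogeneous_linear_form l \<longleftrightarrow> (\<exists>a b. l = affine_poly a b 0) \<and> l \<noteq> 0"

definition distinct_up_to_scalars :: "nat \<Rightarrow> (nat \<Rightarrow> 'a::idom bpoly) \<Rightarrow> bool" where
  "distinct_up_to_scalars n l \<longleftrightarrow>
     (\<forall>i<n. \<forall>j<n. i \<noteq> j \<longrightarrow> (\<forall>c. c \<noteq> 0 \<longrightarrow> l i \<noteq> scal c * l j))"

definition linear_factorization :: "nat \<Rightarrow> (nat \<Rightarrow> 'a::idom bpoly) \<Rightarrow> 'a bpoly \<Rightarrow> bool" where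
  "linear_factorization n l f \<longleftrightarrow>
     f = (\<Prod>i<n. l i) \<and> (\<forall>i<n. linear_form (l i)) \<and> distinct_up_to_scalars n l"

definition product_of_distinct_linear_forms :: "'a::idom bpoly \<Rightarrow> bool" where
  "product_of_distinct_linear_forms f \<longleftrightarrow> (\<exists>n l. linear_factorization n l f)"

text \<open>
  The factors are unique up to order and nonzero scalars, so the condition does not depend on the
  factorization chosen.
\<close>

definition condition_G :: "'a::idom bpoly \<Rightarrow> bool" where
  "condition_G f \<longleftrightarrow>
     (\<exists>n l. linear_factorization n l f \<and>
        (\<forall>i<n. card {j. j < n \<and> generates_algebra {l i, l j}} \<ge> 3))"

definition product_of_four_or_more_homogeneous_forms :: "'a::idom bpoly \<Rightarrow> bool" where
  "product_of_four_or_more_homogeneous_forms f \<longleftrightarrow>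
     (\<exists>n l. n \<ge> 4 \<and> f = (\<Prod>i<n. l i) \<and> (\<forall>i<n. homogeneous_linear_form (l i)) \<and>
        distinct_up_to_scalars n l)"


section \<open>Affine changes of variables\<close>

definition affine_change :: "'a::field^2^2 \<Rightarrow> 'a \<Rightarrow> 'a \<Rightarrow> 'a bpoly \<Rightarrow> 'a bpoly" where
  "affine_change C c1 c2 f =
     scal (1 / (C$1$1 * C$2$2 - C$1$2 * C$2$1)) *
     subst2 f (affine_poly (C$1$1) (C$1$2) c1) (affine_poly (C$2$1) (C$2$2) c2)"

end

theory Submission
  imports Defs "Berlekamp_Zassenhaus.Unique_Factorization_Poly"
begin

text \<open>
  Call a discrete valuation of \<open>k(x,y)\<close> over \<open>k\<close> Poisson for \<open>f\<close> if its valuation ring is closed under the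
  bracket of \<open>K{f}\<close>. If \<open>f\<close> is a nonconstant product of lines satisfying (G), every such valuation is
  nonnegative on \<open>x\<close> and \<open>y\<close>: the form \<open>dx dy / f\<close> vanishes along every divisor at infinity. On the
  other hand the valuation at any prime of \<open>k[x,y]\<close> is Poisson, so \<open>k[x,y]\<close> is the intersection of all
  Poisson valuation rings and every Poisson isomorphism \<open>K{f} \<cong> K{g}\<close> restricts to an automorphism of
  \<open>k[x,y]\<close>. It sends \<open>f\<close> to a constant multiple of \<open>g\<close>, hence lines to lines, and so it is affine.
\<close>

section \<open>The field of rational functions\<close>

text \<open>A Poisson isomorphism is a priori only a birational map, and k(x,y) has far more
  automorphisms than k[x,y]. The polynomial ring must therefore be recovered from the bracket alone;
  valuation rings closed under the bracket are an invariant suited to this. The number three in (G)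
  is a threshold. Suppose min(v(x), v(y)) = -m < 0. Then only one parallel class of lines can have
  value above -m. If e is the largest value of a line and r lines cross that line, a suitable pair
  of elements of the valuation ring has a bracket of value at most (2 - r) m, which is negative once
  r is at least 3. The determinant in the formula is the Jacobian of the resulting automorphism: it
  is a constant D, and f is sent to D times g. An empty product satisfies (G) vacuously but offers
  no line to start from, so the constant case is treated apart.\<close>

lemma rat_add [simp]: "rat (p + q) = rat p + rat q"
  by (simp add: rat_def)

lemma rat_mult [simp]: "rat (p * q) = rat p * rat q"
  by (simp add: rat_def)

lemma rat_0 [simp]: "rat 0 = 0"
  by (simp add: rat_def fract_collapse)

lemma rat_1 [simp]: "rat 1 = 1"
  by (simp add: rat_def fract_collapse)

lemma rat_uminus [simp]: "rat (- p) = - rat p"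
  by (simp add: rat_def)

lemma rat_diff [simp]: "rat (p - q) = rat p - rat q"
  by (simp add: rat_def)

lemma rat_power [simp]: "rat (p ^ n) = rat p ^ n"
  by (induction n) auto

lemma rat_prod: "rat (\<Prod>i\<in>A. h i) = (\<Prod>i\<in>A. rat (h i))"
  by (induction A rule: infinite_finite_induct) auto

lemma rat_eq_iff [simp]: "rat p = rat q \<longleftrightarrow> p = q"
  by (simp add: rat_def eq_fract)

lemma rat_eq_0_iff [simp]: "rat p = 0 \<longleftrightarrow> p = 0"
  using rat_eq_iff[of p 0] by simp

lemma Fract_eq_divide: "b \<noteq> 0 \<Longrightarrow> Fraction_Field.Fract a b = rat a / rat b"
  by (simp add: rat_def)

lemma fract_as_quotient:
  fixes u :: "'a::idom bpoly fract"
  obtains a b where "b \<noteq> 0" "u = rat a / rat b"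
  by (metis Fract_cases Fract_eq_divide)

lemma rat_divide_eq_iff:
  assumes "b \<noteq> 0" "d \<noteq> 0"
  shows "rat a / rat b = rat c / rat d \<longleftrightarrow> a * d = c * b"
proof -
  have "rat a / rat b = rat c / rat d \<longleftrightarrow> rat (a * d) = rat (c * b)"
    unfolding rat_mult by (rule frac_eq_eq) (use assms in auto)
  thus ?thesis unfolding rat_eq_iff .
qed

lemma scal_add [simp]: "scal (c + d) = scal c + scal d"
  by (simp add: scal_def)

lemma scal_mult [simp]: "scal (c * d) = scal c * scal d"
  by (simp add: scal_def)

lemma scal_diff [simp]: "scal (c - d) = scal c - scal d"
  by (simp add: scal_def)

lemma scal_uminus [simp]: "scal (- c) = - scal c"
  by (simp add: scal_def)

lemma scal_0 [simp]: "scal 0 = 0"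
  by (simp add: scal_def)

lemma scal_1 [simp]: "scal 1 = 1"
  by (simp only: scal_def flip: one_pCons)

lemma scal_eq_iff [simp]: "scal c = scal d \<longleftrightarrow> c = d"
  by (simp add: scal_def)

lemma scal_eq_0_iff [simp]: "scal c = 0 \<longleftrightarrow> c = 0"
  by (simp add: scal_def)

lemma scal_of_nat: "scal (of_nat n) = of_nat n"
  by (induction n) auto

lemma rat_of_nat: "rat (of_nat n) = of_nat n"
  by (induction n) auto

lemma varX_neq_0 [simp]: "varX \<noteq> 0" and varY_neq_0 [simp]: "varY \<noteq> 0"
  by (auto simp: varX_def varY_def)

lemma affine_poly_eq_0_iff: "affine_poly a b c = 0 \<longleftrightarrow> a = 0 \<and> b = 0 \<and> c = 0"
  by (auto simp: affine_poly_def scal_def varX_def varY_def)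

lemma affine_poly_in_range_scal_iff: "affine_poly a b c \<in> range scal \<longleftrightarrow> a = 0 \<and> b = 0"
  by (auto simp: affine_poly_def scal_def varX_def varY_def image_iff)

text \<open>As a ring, k[x,y] is generated by the constants, x and y. Identities between
  homomorphisms or derivations thus need to be checked on these generators only.\<close>

lemma bpoly_induct [case_names scal X Y add mult]:
  assumes "\<And>c. P (scal c)" "P varX" "P varY"
    and add: "\<And>p q. P p \<Longrightarrow> P q \<Longrightarrow> P (p + q)"
    and mult: "\<And>p q. P p \<Longrightarrow> P q \<Longrightarrow> P (p * q)"
  shows "P p"
proof (induction p)
  case 0
  show ?case using assms(1)[of 0] by simp
next
  case (pCons r p)
  have "P [:r:]"
  proof (induction r)
    case 0
    show ?case using assms(1)[of 0] by simp
  next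
    case (pCons c r)
    have "[:pCons c r:] = scal c + varX * [:r:]"
      by (simp add: scal_def varX_def)
    thus ?case using add[OF assms(1) mult[OF assms(2) pCons.IH]] by simp
  qed
  moreover have "pCons r p = [:r:] + varY * p"
    by (simp add: varY_def)
  ultimately show ?case using add mult assms(3) pCons.IH by metis
qed

section \<open>Derivations\<close>

definition derivation :: "('k::field \<Rightarrow> 'k) \<Rightarrow> bool" where
  "derivation D \<longleftrightarrow> (\<forall>u v. D (u + v) = D u + D v) \<and> (\<forall>u v. D (u * v) = u * D v + v * D u)"

lemma derivation_add: "derivation D \<Longrightarrow> D (u + v) = D u + D v"
  and derivation_mult: "derivation D \<Longrightarrow> D (u * v) = u * D v + v * D u"
  by (auto simp: derivation_def)

lemma derivation_0: "derivation D \<Longrightarrow> D 0 = 0"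
  by (metis add_cancel_right_right derivation_add)

lemma derivation_1: "derivation D \<Longrightarrow> D 1 = 0"
  by (metis add_cancel_right_right derivation_mult mult_1)

lemma derivation_inverse:
  assumes "derivation D"
  shows "D (inverse u) = - D u / u ^ 2"
proof (cases "u = 0")
  case False
  have "u * D (inverse u) + inverse u * D u = 0"
    using derivation_mult[OF assms, of u "inverse u"] derivation_1[OF assms] False by simp
  thus ?thesis using False by (simp add: field_simps power2_eq_square add_eq_0_iff2)
qed (simp add: derivation_0[OF assms])

lemma derivation_divide:
  assumes "derivation D" "v \<noteq> 0"
  shows "D (u / v) = (D u * v - u * D v) / v ^ 2"
  unfolding divide_inverse derivation_mult[OF assms(1)] derivation_inverse[OF assms(1)]
  using assms(2) by (simp add: field_simps power2_eq_square)

lemma derivation_power: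
  assumes "derivation D"
  shows "D (u ^ Suc n) = of_nat (Suc n) * u ^ n * D u"
  by (induction n) (simp_all add: derivation_mult[OF assms] algebra_simps)

text \<open>Integer exponents are allowed because the exponent in the Laurent monomials below is a
  value of a valuation, which may have either sign.\<close>

lemma derivation_powi:
  assumes "derivation D" "u \<noteq> 0"
  shows "D (u powi e) = of_int e * u powi (e - 1) * D u"
proof -
  have nat: "D (u powi int n) = of_int (int n) * u powi (int n - 1) * D u" for n
    using derivation_power[OF assms(1), of u "n - 1"] derivation_1[OF assms(1)]
    by (cases n) (auto simp add: power_int_def nat_add_distrib)
  show ?thesis
  proof (cases "e \<ge> 0")
    case True
    thus ?thesis using nat[of "nat e"] by simp
  next
    case False
    have "D (u powi e) = D (inverse (u powi int (nat (- e))))"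
      using False by (simp add: power_int_def power_inverse)
    also have "\<dots> = of_int e * (u powi (- e - 1) / (u powi (- e)) ^ 2) * D u"
      unfolding derivation_inverse[OF assms(1)] nat using False by simp
    also have "u powi (- e - 1) / (u powi (- e)) ^ 2 = u powi (e - 1)"
      using assms(2) by (simp add: power2_eq_square flip: power_int_add power_int_diff)
    finally show ?thesis .
  qed
qed

text \<open>Primed letters stand for derivatives. Additivity and the Leibniz rule of the
  quotient-rule extension become pure field identities in independent letters, here and in
  \<open>quotient_rule_mult\<close>.\<close>

lemma quotient_rule_add:
  fixes a :: "'k::field"
  assumes "b \<noteq> 0" "d \<noteq> 0"
  shows "((a * d' + d * a' + (c * b' + b * c')) * (b * d) - (a * d + c * b) * (b * d' + d * b')) /
      (b * d * (b * d)) = (a' * b - a * b') / (b * b) + (c' * d - c * d') / (d * d)"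
proof -
  have "(a' * b - a * b') / (b * b) = ((a' * b - a * b') * (d * d)) / (b * d * (b * d))"
    "(c' * d - c * d') / (d * d) = ((c' * d - c * d') * (b * b)) / (b * d * (b * d))"
    using assms by simp_all
  moreover have "(a * d' + d * a' + (c * b' + b * c')) * (b * d) - (a * d + c * b) * (b * d' + d * b') =
      (a' * b - a * b') * (d * d) + (c' * d - c * d') * (b * b)"
    by (simp add: algebra_simps)
  ultimately show ?thesis
    by (simp only: add_divide_distrib)
qed

lemma quotient_rule_mult:
  fixes a :: "'k::field"
  assumes "b \<noteq> 0" "d \<noteq> 0"
  shows "((a * c' + c * a') * (b * d) - (a * c) * (b * d' + d * b')) / (b * d * (b * d)) =
      a / b * ((c' * d - c * d') / (d * d)) + c / d * ((a' * b - a * b') / (b * b))"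
proof -
  have "a / b * ((c' * d - c * d') / (d * d)) = (a * (c' * d - c * d') * b) / (b * d * (b * d))"
    "c / d * ((a' * b - a * b') / (b * b)) = (c * (a' * b - a * b') * d) / (b * d * (b * d))"
    using assms by simp_all
  moreover have "(a * c' + c * a') * (b * d) - (a * c) * (b * d' + d * b') =
      a * (c' * d - c * d') * b + c * (a' * b - a * b') * d"
    by (simp add: algebra_simps)
  ultimately show ?thesis
    by (simp only: add_divide_distrib)
qed

lemma fract_deriv_derivation:
  fixes d :: "'a::idom bpoly \<Rightarrow> 'a bpoly"
  assumes add: "\<And>p q. d (p + q) = d p + d q" and mult: "\<And>p q. d (p * q) = p * d q + q * d p"
  shows "derivation (fract_deriv d)"
proof -
  have quot: "fract_deriv d (rat a / rat b) = (rat (d a) * rat b - rat a * rat (d b)) / (rat b * rat b)"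
    if "b \<noteq> 0" for a b
    using fract_deriv_Fract[of d, OF mult that, of a] that
    by (simp add: Fract_eq_divide del: divide_fract)
  show ?thesis
    unfolding derivation_def
  proof (intro conjI allI)
    fix u v :: "'a bpoly fract"
    obtain a b where ab: "b \<noteq> 0" "u = rat a / rat b" by (rule fract_as_quotient)
    obtain a' b' where ab': "b' \<noteq> 0" "v = rat a' / rat b'" by (rule fract_as_quotient)
    have "u + v = rat (a * b' + a' * b) / rat (b * b')"
      unfolding ab(2) ab'(2) rat_add rat_mult by (rule add_frac_eq) (use ab ab' in auto)
    moreover have bb: "b * b' \<noteq> 0" using ab ab' by simp
    ultimately have "fract_deriv d (u + v) =
        (rat (d (a * b' + a' * b)) * rat (b * b') - rat (a * b' + a' * b) * rat (d (b * b'))) /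
        (rat (b * b') * rat (b * b'))"
      by (simp only: quot not_False_eq_True)
    thus "fract_deriv d (u + v) = fract_deriv d u + fract_deriv d v"
      using quotient_rule_add[of "rat b" "rat b'" "rat a" "rat (d b')" "rat (d a)" "rat a'" "rat (d b)"
          "rat (d a')"] ab(1) ab'(1)
      unfolding quot[OF ab(1), of a, folded ab(2)] quot[OF ab'(1), of a', folded ab'(2)]
        rat_add rat_mult add mult rat_eq_0_iff by metis
    have "u * v = rat (a * a') / rat (b * b')"
      unfolding ab(2) ab'(2) rat_mult by (rule times_divide_times_eq)
    hence "fract_deriv d (u * v) =
        (rat (d (a * a')) * rat (b * b') - rat (a * a') * rat (d (b * b'))) /
        (rat (b * b') * rat (b * b'))"
      using bb by (simp only: quot not_False_eq_True)
    thus "fract_deriv d (u * v) = u * fract_deriv d v + v * fract_deriv d u"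
      using quotient_rule_mult[of "rat b" "rat b'" "rat a" "rat (d a')" "rat a'" "rat (d a)" "rat (d b')"
          "rat (d b)"] ab(1) ab'(1)
      unfolding quot[OF ab(1), of a, folded ab(2)] quot[OF ab'(1), of a', folded ab'(2)]
        rat_add rat_mult add mult rat_eq_0_iff by (metis ab(2) ab'(2))
  qed
qed

lemma poly_dx_add: "poly_dx (p + q) = poly_dx p + poly_dx q"
  by (rule poly_eqI) (simp add: coeff_poly_dx pderiv_add)

lemma poly_dy_add: "poly_dy (p + q) = poly_dy p + poly_dy q"
  by (simp add: poly_dy_def pderiv_add)

lemma poly_dx_pCons: "poly_dx (pCons r p) = pCons (pderiv r) (poly_dx p)"
  by (rule poly_eqI) (simp add: coeff_poly_dx coeff_pCons split: nat.split)

lemma poly_dx_0 [simp]: "poly_dx 0 = 0" and poly_dy_0 [simp]: "poly_dy 0 = 0"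
  by (simp_all add: poly_dx_def poly_dy_def)

lemma poly_dx_scal [simp]: "poly_dx (scal c) = 0" and poly_dy_scal [simp]: "poly_dy (scal c) = 0"
  by (simp_all add: poly_dx_pCons poly_dy_def scal_def pderiv_pCons)

lemma poly_dx_1 [simp]: "poly_dx 1 = 0"
  unfolding scal_1[symmetric] by (rule poly_dx_scal)

lemma poly_dy_1 [simp]: "poly_dy 1 = 0"
  unfolding scal_1[symmetric] by (rule poly_dy_scal)

lemma poly_dx_varX [simp]: "poly_dx varX = 1" and poly_dx_varY [simp]: "poly_dx varY = 0"
  and poly_dy_varX [simp]: "poly_dy varX = 0" and poly_dy_varY [simp]: "poly_dy varY = 1"
  by (simp_all add: poly_dx_pCons poly_dy_def varX_def varY_def pderiv_pCons)

lemma derivation_dx: "derivation dx" and derivation_dy: "derivation dy"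
  unfolding dx_def dy_def
  by (rule fract_deriv_derivation; simp add: poly_dx_add poly_dx_mult poly_dy_add poly_dy_mult)+

lemma dx_rat [simp]: "dx (rat p) = rat (poly_dx p)"
  and dy_rat [simp]: "dy (rat p) = rat (poly_dy p)"
  by (simp_all add: rat_def dx_Fract dy_Fract)

section \<open>Poisson valuations\<close>

text \<open>The value at 0 would be infinite and is left unconstrained; \<open>val_ge\<close> puts 0
  into every level instead. Values need not fill the integers, so the trivial valuation is
  included.\<close>

definition valuation :: "('a::field bpoly fract \<Rightarrow> int) \<Rightarrow> bool" where
  "valuation v \<longleftrightarrow>
     (\<forall>u w. u \<noteq> 0 \<longrightarrow> w \<noteq> 0 \<longrightarrow> v (u * w) = v u + v w) \<and>
     (\<forall>u w. u \<noteq> 0 \<longrightarrow> w \<noteq> 0 \<longrightarrow> u + w \<noteq> 0 \<longrightarrow> min (v u) (v w) \<le> v (u + w)) \<and>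
     (\<forall>c. c \<noteq> 0 \<longrightarrow> v (rat (scal c)) = 0)"

definition val_ge :: "('a::field bpoly fract \<Rightarrow> int) \<Rightarrow> int \<Rightarrow> 'a bpoly fract \<Rightarrow> bool" where
  "val_ge v k u \<longleftrightarrow> u = 0 \<or> k \<le> v u"

definition poisson_valuation ::
  "'a::field bpoly fract \<Rightarrow> ('a bpoly fract \<Rightarrow> int) \<Rightarrow> bool" where
  "poisson_valuation f v \<longleftrightarrow> valuation v \<and>
     (\<forall>u w. val_ge v 0 u \<longrightarrow> val_ge v 0 w \<longrightarrow> val_ge v 0 (poisson_bracket f u w))"

lemma valuation_mult: "valuation v \<Longrightarrow> u \<noteq> 0 \<Longrightarrow> w \<noteq> 0 \<Longrightarrow> v (u * w) = v u + v w"
  and valuation_scal: "valuation v \<Longrightarrow> c \<noteq> 0 \<Longrightarrow> v (rat (scal c)) = 0"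
  by (auto simp: valuation_def)

lemma valuation_1: "valuation v \<Longrightarrow> v 1 = 0"
  using valuation_scal[of v 1] by simp

lemma valuation_uminus:
  assumes "valuation v"
  shows "v (- u) = v u"
proof (cases "u = 0")
  case False
  have "v (- u) = v (rat (scal (-1)) * u)" by simp
  also have "\<dots> = v u"
    using False by (subst valuation_mult[OF assms]) (auto simp: valuation_scal[OF assms] simp del: scal_uminus)
  finally show ?thesis .
qed simp

lemma valuation_inverse:
  assumes "valuation v" "u \<noteq> 0"
  shows "v (inverse u) = - v u"
  using valuation_mult[OF assms(1), of u "inverse u"] valuation_1[OF assms(1)] assms(2) by simp

lemma valuation_power:
  assumes "valuation v" "u \<noteq> 0"
  shows "v (u ^ n) = int n * v u"
  using assms(2)
  by (induction n) (auto simp: valuation_1[OF assms(1)] valuation_mult[OF assms(1)] algebra_simps)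

lemma valuation_powi:
  assumes "valuation v" "u \<noteq> 0"
  shows "v (u powi e) = e * v u"
  using assms(2)
  by (auto simp: power_int_def valuation_power[OF assms(1)] valuation_inverse[OF assms(1)])

lemma valuation_prod:
  assumes "valuation v" "finite A" "\<And>i. i \<in> A \<Longrightarrow> h i \<noteq> 0"
  shows "v (\<Prod>i\<in>A. h i) = (\<Sum>i\<in>A. v (h i))"
  using assms(2,3)
  by (induction rule: finite_induct) (auto simp: valuation_1[OF assms(1)] valuation_mult[OF assms(1)])

lemma val_ge_add:
  assumes "valuation v" "val_ge v k u" "val_ge v k w"
  shows "val_ge v k (u + w)"
proof (cases "u = 0 \<or> w = 0 \<or> u + w = 0")
  case True
  thus ?thesis using assms by (auto simp: val_ge_def)
next
  case False
  hence "min (v u) (v w) \<le> v (u + w)" using assms(1) by (auto simp: valuation_def)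
  thus ?thesis using assms(2,3) False by (auto simp: val_ge_def)
qed

lemma val_ge_mult:
  assumes "valuation v" "val_ge v k u" "val_ge v l w"
  shows "val_ge v (k + l) (u * w)"
  using assms valuation_mult[OF assms(1), of u w] unfolding val_ge_def
  by (cases "u = 0"; cases "w = 0") auto

lemma val_ge_uminus: "valuation v \<Longrightarrow> val_ge v k (- u) \<longleftrightarrow> val_ge v k u"
  by (simp add: val_ge_def valuation_uminus)

lemma val_ge_diff:
  assumes "valuation v" "val_ge v k u" "val_ge v k w"
  shows "val_ge v k (u - w)"
  using val_ge_add[OF assms(1,2), of "- w"] assms by (simp add: val_ge_uminus)

lemma val_ge_scal: "valuation v \<Longrightarrow> k \<le> 0 \<Longrightarrow> val_ge v k (rat (scal c))"
  by (cases "c = 0") (auto simp: val_ge_def valuation_scal)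

lemma val_ge_scal_mult: "valuation v \<Longrightarrow> val_ge v k u \<Longrightarrow> val_ge v k (rat (scal c) * u)"
  using val_ge_mult[of v 0 "rat (scal c)" k u] by (simp add: val_ge_scal)

lemma val_ge_affine:
  assumes "valuation v" "k \<le> 0" "val_ge v k (rat varX)" "val_ge v k (rat varY)"
  shows "val_ge v k (rat (affine_poly a b c))"
  unfolding affine_poly_def rat_add rat_mult
  using assms by (intro val_ge_add val_ge_scal_mult val_ge_scal)

lemma derivatives_affine_poly:
  "dx (rat (affine_poly a b c)) = rat (scal a)" "dy (rat (affine_poly a b c)) = rat (scal b)"
  unfolding affine_poly_def dx_rat dy_rat poly_dx_add poly_dx_mult poly_dy_add poly_dy_mult by simp_all

text \<open>
  The two Laurent monomials below are chosen to have nonnegative value at a hypothetical valuation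
  that is negative on \<open>x\<close> or \<open>y\<close>, while their bracket has negative value.
\<close>

lemma poisson_bracket_monomials:
  assumes "u \<noteq> 0" "w \<noteq> 0" "m > 0"
  shows "poisson_bracket f (inverse u) (w ^ m * u powi e) =
    - (of_nat m * w ^ (m - 1) * u powi (e - 2) * ((dx u * dy w - dy u * dx w) * f))"
proof -
  obtain n where m: "m = Suc n" using assms(3) gr0_conv_Suc by auto
  have e1: "u powi (e - 1) = u * u powi (e - 2)" "u powi e = u ^ 2 * u powi (e - 2)"
    using assms(1) by (simp_all add: power_int_diff power2_eq_square field_simps)
  define P where "P = u powi (e - 2)"
  have D: "D (inverse u) = - D u / u ^ 2"
     "D (w ^ m * u powi e) = w ^ m * (of_int e * (u * P) * D u)
        + (u ^ 2 * P) * (of_nat m * w ^ n * D w)"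
    if "derivation D" for D
    using derivation_inverse[OF that] derivation_mult[OF that] derivation_power[OF that, of w n]
      derivation_powi[OF that assms(1), of e] by (simp_all add: m e1 P_def)
  \<comment> \<open>The terms with \<open>E\<close> come from differentiating the power of
    \<open>u\<close>. They are multiples of the derivative of \<open>u\<close>, as is the derivative
    of \<open>inverse u\<close>, so antisymmetry cancels them.\<close>
  have identity: "(- p / u ^ 2) * (W * (E * (u * P) * q) + (u ^ 2 * P) * (M * q')) -
      (- q / u ^ 2) * (W * (E * (u * P) * p) + (u ^ 2 * P) * (M * p')) = - (M * P * (p * q' - q * p'))"
    for p q p' q' W E M
  proof -
    have "(- p / u ^ 2) * (W * (E * (u * P) * q) + (u ^ 2 * P) * (M * q')) -
      (- q / u ^ 2) * (W * (E * (u * P) * p) + (u ^ 2 * P) * (M * p')) =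
      (q * (W * (E * (u * P) * p) + (u ^ 2 * P) * (M * p')) -
       p * (W * (E * (u * P) * q) + (u ^ 2 * P) * (M * q'))) / u ^ 2"
      by (simp add: diff_divide_distrib)
    also have "q * (W * (E * (u * P) * p) + (u ^ 2 * P) * (M * p')) -
       p * (W * (E * (u * P) * q) + (u ^ 2 * P) * (M * q')) = u ^ 2 * - (M * P * (p * q' - q * p'))"
      by (simp add: algebra_simps)
    finally show ?thesis using assms(1) by simp
  qed
  show ?thesis
    unfolding poisson_bracket_def D[OF derivation_dx] D[OF derivation_dy] P_def[symmetric] identity
    using m by simp
qed

section \<open>Values of the lines of an arrangement at a Poisson valuation\<close>

lemma proportional_pairs:
  fixes x y :: "'k::field"
  assumes "x * y' = x' * y" "x' \<noteq> 0 \<or> y' \<noteq> 0"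
  obtains s where "x = s * x'" "y = s * y'"
proof (cases "x' = 0")
  case True
  thus thesis using that[of "y / y'"] assms by simp
next
  case False
  thus thesis using that[of "x / x'"] assms by (simp add: field_simps)
qed

text \<open>Common ground for (G) and for four or more homogeneous forms: in both cases each line is
  crossed by at least three others, which the determinant of the linear parts expresses. The empty
  arrangement is allowed.\<close>

locale line_arrangement =
  fixes n :: nat and a b c :: "nat \<Rightarrow> 'a::field_char_0"
  assumes nonconst: "i < n \<Longrightarrow> a i \<noteq> 0 \<or> b i \<noteq> 0"
    and distinct: "distinct_up_to_scalars n (\<lambda>i. affine_poly (a i) (b i) (c i))"
    and three: "i < n \<Longrightarrow> card {j. j < n \<and> a i * b j - a j * b i \<noteq> 0} \<ge> 3"
begin

definition "form i = affine_poly (a i) (b i) (c i)"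

lemma form_neq_0: "i < n \<Longrightarrow> form i \<noteq> 0"
  using nonconst by (auto simp: form_def affine_poly_eq_0_iff)

text \<open>Cramer's rule: two crossing lines serve as affine coordinates.\<close>

lemma coordinates_from_forms:
  fixes i j
  defines "d \<equiv> a i * b j - a j * b i"
  assumes "d \<noteq> 0"
  shows "varX = scal (b j / d) * form i + scal (- b i / d) * form j + scal ((b i * c j - b j * c i) / d)"
    and "varY = scal (- a j / d) * form i + scal (a i / d) * form j + scal ((a j * c i - a i * c j) / d)"
proof -
  have *: "scal s * affine_poly p q r + scal t * affine_poly p' q' r' + scal w =
      affine_poly (s * p + t * p') (s * q + t * q') (s * r + t * r' + w)" for s t p q r p' q' r' w :: 'a
    by (simp add: affine_poly_def algebra_simps)
  have XY: "varX = affine_poly 1 0 (0::'a)" "varY = affine_poly 0 1 (0::'a)"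
    by (simp_all add: affine_poly_def)
  show "varX = scal (b j / d) * form i + scal (- b i / d) * form j + scal ((b i * c j - b j * c i) / d)"
    "varY = scal (- a j / d) * form i + scal (a i / d) * form j + scal ((a j * c i - a i * c j) / d)"
    unfolding form_def * unfolding XY
    using assms(2)
    by (intro arg_cong3[of _ _ _ _ _ _ affine_poly]; simp add: divide_simps; simp add: d_def algebra_simps)+
qed

text \<open>Proportional linear parts leave only a difference of constants, and this difference is
  nonzero because the forms are distinct up to scalars.\<close>

lemma parallel_forms:
  assumes "i < n" "k < n" "i \<noteq> k" "a i * b k - a k * b i = 0"
  obtains s t where "t \<noteq> 0" "form k = scal s * form i + scal t"
proof -
  obtain s where s: "a k = s * a i" "b k = s * b i"
    using proportional_pairs[OF _ nonconst[OF assms(1)], of "a k" "b k"] assms(4) by auto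
  have "s \<noteq> 0" using s nonconst[OF assms(2)] by auto
  have k: "form k = scal s * form i + scal (c k - s * c i)"
    by (simp add: form_def s affine_poly_def algebra_simps)
  moreover have "form k \<noteq> scal s * form i"
    using distinct assms(1-3) \<open>s \<noteq> 0\<close> unfolding distinct_up_to_scalars_def form_def by auto
  ultimately have "c k - s * c i \<noteq> 0" by auto
  thus thesis using k that by blast
qed

text \<open>If -m is the smaller value on the coordinates and m > 0, let line i have the largest
  value e. Every line crossing it has value exactly -m, and every other line apart from i has value
  at most 0, so the product has value at most e - 3m. The bracket of \<open>inverse (L j)\<close>
  and \<open>L i ^ m * L j powi e\<close>, for a line j crossing line i, then has negative value
  although both entries have nonnegative value.\<close>

lemma poisson_valuation_coordinates_nonneg:
  assumes "poisson_valuation (rat (\<Prod>i<n. form i)) v" "n > 0"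
  shows "v (rat varX) \<ge> 0 \<and> v (rat varY) \<ge> 0"
proof (rule ccontr)
  assume neg: "\<not> ?thesis"
  have val: "valuation v" using assms by (simp add: poisson_valuation_def)
  define L where "L i = rat (form i)" for i
  have L0: "L i \<noteq> 0" if "i < n" for i using form_neq_0[OF that] by (simp add: L_def)
  define m where "m = - min (v (rat varX)) (v (rat varY))"
  have m: "m > 0" using neg by (auto simp: m_def)
  have vXY: "val_ge v (- m) (rat varX)" "val_ge v (- m) (rat varY)"
    by (auto simp: m_def val_ge_def)
  have L_ge: "v (L i) \<ge> - m" if "i < n" for i
    using val_ge_affine[OF val _ vXY, of "a i" "b i" "c i"] m L0[OF that]
    by (auto simp: L_def form_def val_ge_def)
  have nonparallel: "v (L i) = - m \<or> v (L j) = - m"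
    if "i < n" "j < n" "a i * b j - a j * b i \<noteq> 0" for i j
  proof (rule ccontr)
    assume "\<not> ?thesis"
    hence *: "val_ge v (1 - m) (L i)" "val_ge v (1 - m) (L j)"
      using L_ge[OF that(1)] L_ge[OF that(2)] by (auto simp: val_ge_def)
    \<comment> \<open>Since m is a positive integer, \<open>1 - m\<close> is at most 0, so the
      constant in Cramer's rule does no harm. Both coordinates would exceed -m, against the choice
      of m.\<close>
    have "val_ge v (1 - m) (rat varX)"
      unfolding coordinates_from_forms(1)[OF that(3)] rat_add rat_mult L_def[symmetric]
      using m * by (intro val_ge_add val_ge_scal_mult val_ge_scal val) auto
    moreover have "val_ge v (1 - m) (rat varY)"
      unfolding coordinates_from_forms(2)[OF that(3)] rat_add rat_mult L_def[symmetric]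
      using m * by (intro val_ge_add val_ge_scal_mult val_ge_scal val) auto
    ultimately show False by (auto simp: val_ge_def m_def)
  qed
  \<comment> \<open>Otherwise a nonzero constant, being a combination of the two forms, would have
    positive value.\<close>
  have parallel: "v (L i) \<le> 0 \<or> v (L k) \<le> 0"
    if ik: "i < n" "k < n" "i \<noteq> k" "a i * b k - a k * b i = 0" for i k
  proof (rule ccontr)
    assume "\<not> ?thesis"
    hence *: "val_ge v 1 (L i)" "val_ge v 1 (L k)" by (auto simp: val_ge_def)
    obtain s t where st: "t \<noteq> 0" "form k = scal s * form i + scal t"
      using parallel_forms[OF ik] .
    hence "rat (scal t) = L k - rat (scal s) * L i" by (simp add: L_def)
    hence "val_ge v 1 (rat (scal t))" using * by (metis val_ge_diff val_ge_scal_mult val)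
    thus False using st valuation_scal[OF val st(1)] by (simp add: val_ge_def)
  qed
  obtain i where i: "i < n" "\<And>k. k < n \<Longrightarrow> v (L k) \<le> v (L i)"
  proof -
    have "Max ((\<lambda>k. v (L k)) ` {..<n}) \<in> (\<lambda>k. v (L k)) ` {..<n}"
      using assms(2) by (intro Max_in) auto
    then obtain i where "i < n" "Max ((\<lambda>k. v (L k)) ` {..<n}) = v (L i)" by auto
    thus thesis using that[of i] by (metis Max_ge finite_imageI finite_lessThan imageI lessThan_iff)
  qed
  define e where "e = v (L i)"
  define J where "J = {j. j < n \<and> a i * b j - a j * b i \<noteq> 0}"
  \<comment> \<open>If \<open>v (L i)\<close> is itself -m, maximality pushes \<open>v (L j)\<close>
    down to -m; otherwise \<open>nonparallel\<close> applies.\<close>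
  have J: "v (L j) = - m" if "j \<in> J" for j
    using nonparallel[OF i(1), of j] that L_ge[of j] i(2)[of j] by (auto simp: J_def)
  \<comment> \<open>A parallel form of positive value would make the maximal value
    \<open>v (L i)\<close> positive too, against \<open>parallel\<close>.\<close>
  have le0: "v (L k) \<le> 0" if "k < n" "k \<noteq> i" for k
    using J[of k] parallel[OF i(1), of k] i(2)[of k] that m
    by (cases "a i * b k = a k * b i") (auto simp: J_def)
  have iJ: "i \<notin> J" by (auto simp: J_def)
  have "finite J" "J \<subseteq> {..<n}" by (auto simp: J_def)
  have "v (\<Prod>k<n. L k) = (\<Sum>k<n. v (L k))"
    using L0 by (intro valuation_prod[OF val]) auto
  also have "\<dots> = v (L i) + (\<Sum>k\<in>{..<n} - {i}. v (L k))"
    using i(1) by (intro sum.remove) auto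
  also have "(\<Sum>k\<in>{..<n} - {i}. v (L k)) = (\<Sum>k\<in>{..<n} - {i} - J. v (L k)) + (\<Sum>k\<in>J. v (L k))"
    using \<open>J \<subseteq> _\<close> iJ by (intro sum.subset_diff) auto
  also have "(\<Sum>k\<in>J. v (L k)) = - m * int (card J)"
    using J by simp
  also have "(\<Sum>k\<in>{..<n} - {i} - J. v (L k)) \<le> 0"
    using le0 by (intro sum_nonpos) auto
  also have "- m * int (card J) \<le> - m * 3"
    using m three[OF i(1)] by (simp add: J_def)
  finally have vf: "v (\<Prod>k<n. L k) \<le> e - 3 * m" by (simp add: e_def)
  have "J \<noteq> {}" using three[OF i(1)] unfolding J_def[symmetric] by auto
  then obtain j where j: "j \<in> J" by auto
  hence jn: "j < n" "a i * b j - a j * b i \<noteq> 0" by (auto simp: J_def)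
  have m': "nat m > 0" using m by simp
  note nz = L0[OF i(1)] L0[OF jn(1)]
  \<comment> \<open>The inverse has value m. The exponents m and e are chosen so that the second
    monomial has value m e - e m = 0.\<close>
  have "val_ge v 0 (inverse (L j))"
    using J[OF j] m nz by (simp add: val_ge_def valuation_inverse[OF val])
  moreover have "val_ge v 0 (L i ^ nat m * L j powi e)"
    using m J[OF j] nz
    by (simp add: val_ge_def valuation_mult[OF val] valuation_power[OF val] valuation_powi[OF val] e_def)
  ultimately have "val_ge v 0 (poisson_bracket (\<Prod>k<n. L k) (inverse (L j)) (L i ^ nat m * L j powi e))"
    using assms(1) by (auto simp: poisson_valuation_def rat_prod L_def)
  \<comment> \<open>Two affine forms have a constant Jacobian, nonzero because j lies in
    \<open>J\<close>. The bracket is thus a nonzero constant times a product, and its value is a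
    sum.\<close>
  also have "poisson_bracket (\<Prod>k<n. L k) (inverse (L j)) (L i ^ nat m * L j powi e) =
      - (rat (scal (of_nat (nat m))) * (L i ^ (nat m - 1) * (L j powi (e - 2) *
         (rat (scal (a j * b i - a i * b j)) * (\<Prod>k<n. L k)))))"
    unfolding poisson_bracket_monomials[OF nz(2,1) m'] unfolding L_def form_def derivatives_affine_poly
    by (simp add: scal_of_nat rat_of_nat algebra_simps)
  finally have "val_ge v 0 (rat (scal (of_nat (nat m))) * (L i ^ (nat m - 1) * (L j powi (e - 2) *
         (rat (scal (a j * b i - a i * b j)) * (\<Prod>k<n. L k)))))"
    by (simp only: val_ge_uminus[OF val])
  moreover have d: "a j * b i - a i * b j \<noteq> 0" "(of_nat (nat m) :: 'a) \<noteq> 0"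
    using jn m' by auto
  moreover have "(\<Prod>k<n. L k) \<noteq> 0" using L0 by simp
  ultimately have "0 \<le> int (nat m - 1) * e + ((e - 2) * v (L j) + v (\<Prod>k<n. L k))"
    using nz valuation_scal[OF val d(1)] valuation_scal[OF val d(2)] unfolding val_ge_def
    by (simp add: valuation_mult[OF val] valuation_power[OF val] valuation_powi[OF val] e_def
        del: scal_diff scal_mult)
  \<comment> \<open>With \<open>v (L j) = - m\<close> all terms in e cancel, which leaves 2m -
    3m.\<close>
  also have "\<dots> \<le> (m - 1) * e - (e - 2) * m + (e - 3 * m)"
    using vf m unfolding J[OF j] by (simp add: algebra_simps)
  also have "\<dots> = - m" by (simp add: algebra_simps)
  finally show False using m by simp
qed

end

section \<open>Valuations of k(x,y) from functions on k[x,y]\<close>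

definition fract_val :: "('a::field bpoly \<Rightarrow> int) \<Rightarrow> 'a bpoly fract \<Rightarrow> int" where
  "fract_val w u = (let (p, q) = (SOME (p, q). q \<noteq> 0 \<and> u = rat p / rat q) in w p - w q)"

text \<open>Additivity on products makes the chosen representative immaterial: cross-multiplying two
  representations gives equal differences.\<close>

lemma fract_val_quotient:
  fixes w :: "'a::field bpoly \<Rightarrow> int"
  assumes mult: "\<And>p q. p \<noteq> 0 \<Longrightarrow> q \<noteq> 0 \<Longrightarrow> w (p * q) = w p + w q"
    and "a \<noteq> 0" "b \<noteq> 0"
  shows "fract_val w (rat a / rat b) = w a - w b"
proof -
  obtain p q where pq: "(SOME (p, q). q \<noteq> 0 \<and> rat a / rat b = rat p / rat q) = (p, q)"
    by (rule prod.exhaust)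
  have "case (p, q) of (p, q) \<Rightarrow> q \<noteq> 0 \<and> rat a / rat b = rat p / rat q"
    unfolding pq[symmetric] by (rule someI[of _ "(a, b)"]) (use assms in simp)
  hence q: "q \<noteq> 0" "a * q = p * b"
    using assms(3) by (auto simp: rat_divide_eq_iff)
  hence "p \<noteq> 0" using assms(2,3) by auto
  hence "w a + w q = w p + w b"
    using mult[of a q] mult[of p b] q assms(2,3) by simp
  thus ?thesis by (simp add: fract_val_def pq)
qed

lemma valuation_fract_val:
  fixes w :: "'a::field bpoly \<Rightarrow> int"
  assumes mult: "\<And>p q. p \<noteq> 0 \<Longrightarrow> q \<noteq> 0 \<Longrightarrow> w (p * q) = w p + w q"
    and add: "\<And>p q. p \<noteq> 0 \<Longrightarrow> q \<noteq> 0 \<Longrightarrow> p + q \<noteq> 0 \<Longrightarrow> min (w p) (w q) \<le> w (p + q)"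
    and scal: "\<And>c. c \<noteq> 0 \<Longrightarrow> w (scal c) = 0"
  shows "valuation (fract_val w)"
  unfolding valuation_def
proof (intro conjI allI impI)
  note quot = fract_val_quotient[of w, OF mult]
  fix u v :: "'a bpoly fract"
  assume nz: "u \<noteq> 0" "v \<noteq> 0"
  obtain a b where ab: "b \<noteq> 0" "u = rat a / rat b" by (rule fract_as_quotient)
  obtain a' b' where ab': "b' \<noteq> 0" "v = rat a' / rat b'" by (rule fract_as_quotient)
  have a: "a \<noteq> 0" "a' \<noteq> 0" using nz ab ab' by auto
  note nzs = a ab(1) ab'(1)
  have "u * v = rat (a * a') / rat (b * b')"
    by (simp add: ab ab')
  thus "fract_val w (u * v) = fract_val w u + fract_val w v"
    using nzs quot[of "a * a'" "b * b'"] quot[of a b] quot[of a' b'] by (simp add: ab ab' mult)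
  assume sum: "u + v \<noteq> 0"
  have s: "u + v = rat (a * b' + a' * b) / rat (b * b')"
    unfolding ab(2) ab'(2) rat_add rat_mult by (rule add_frac_eq) (use ab ab' in auto)
  have s0: "a * b' + a' * b \<noteq> 0" using sum unfolding s by fastforce
  have "fract_val w (u + v) = w (a * b' + a' * b) - (w b + w b')"
    unfolding s using nzs s0 by (subst quot) (auto simp: mult)
  moreover have "min (w a + w b') (w a' + w b) \<le> w (a * b' + a' * b)"
    using add[of "a * b'" "a' * b"] s0 nzs by (simp add: mult)
  ultimately show "min (fract_val w u) (fract_val w v) \<le> fract_val w (u + v)"
    using quot[of a b] quot[of a' b'] nzs by (simp add: ab ab')
next
  fix c :: 'a
  assume "c \<noteq> 0"
  thus "fract_val w (rat (scal c)) = 0"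
    using fract_val_quotient[of w "scal c" 1, OF mult] scal[of c] scal[of 1] by simp
qed

text \<open>The bracket is a polynomial in f and the partial derivatives, and a valuation ring is
  closed under ring operations.\<close>

lemma poisson_valuationI:
  assumes "valuation v" "val_ge v 0 f"
    and "\<And>u. val_ge v 0 u \<Longrightarrow> val_ge v 0 (dx u)" "\<And>u. val_ge v 0 u \<Longrightarrow> val_ge v 0 (dy u)"
  shows "poisson_valuation f v"
proof -
  have mult: "val_ge v 0 (u * w)" if "val_ge v 0 u" "val_ge v 0 w" for u w
    using val_ge_mult[OF assms(1) that] by simp
  show ?thesis
    unfolding poisson_valuation_def poisson_bracket_def
    using assms by (auto intro!: mult val_ge_diff)
qed

section \<open>The valuation at a prime polynomial\<close>

text \<open>For nonzero p this is the total degree of the leading monomial in the lexicographic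
  order with y before x. It is additive on products, vanishes exactly on constants and equals 1 on
  lines, so it serves to detect units, to prove lines irreducible and as a termination
  measure.\<close>

definition bsize :: "'a::field bpoly \<Rightarrow> nat" where
  "bsize p = degree p + degree (lead_coeff p)"

lemma bsize_mult: "p \<noteq> 0 \<Longrightarrow> q \<noteq> 0 \<Longrightarrow> bsize (p * q) = bsize p + bsize q"
  by (simp add: bsize_def degree_mult_eq coeff_mult_degree_sum)

lemma bsize_eq_0_iff: "p \<noteq> 0 \<Longrightarrow> bsize p = 0 \<longleftrightarrow> (\<exists>c. p = scal c)"
proof
  assume "bsize p = 0" "p \<noteq> 0"
  then obtain r where "p = [:r:]" "degree r = 0"
    by (auto simp: bsize_def elim!: degree_eq_zeroE)
  thus "\<exists>c. p = scal c" by (auto simp: scal_def elim!: degree_eq_zeroE)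
qed (auto simp: bsize_def scal_def)

lemma bpoly_unit_iff: "p dvd 1 \<longleftrightarrow> (\<exists>c. c \<noteq> 0 \<and> p = scal c)" for p :: "'a::field bpoly"
proof
  assume "p dvd 1"
  then obtain q where q: "1 = p * q" by (elim dvdE)
  hence "p \<noteq> 0" "q \<noteq> 0" by auto
  moreover have "bsize (1 :: 'a bpoly) = 0" by (simp add: bsize_def)
  ultimately have "bsize p = 0" using bsize_mult[of p q] q by simp
  thus "\<exists>c. c \<noteq> 0 \<and> p = scal c" using bsize_eq_0_iff[OF \<open>p \<noteq> 0\<close>] \<open>p \<noteq> 0\<close> by auto
next
  assume "\<exists>c. c \<noteq> 0 \<and> p = scal c"
  then obtain c where "c \<noteq> 0" "p = scal c" by auto
  hence "1 = p * scal (1 / c)" by (simp flip: scal_mult)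
  thus "p dvd 1" by (rule dvdI)
qed

lemma bsize_prime_pos:
  fixes \<pi> :: "'a::field bpoly"
  assumes "prime_elem \<pi>"
  shows "bsize \<pi> > 0"
proof (rule ccontr)
  assume "\<not> bsize \<pi> > 0"
  have "\<pi> \<noteq> 0" using assms by (rule prime_elem_not_zeroI)
  then obtain c where "\<pi> = scal c" using bsize_eq_0_iff[of \<pi>] \<open>\<not> bsize \<pi> > 0\<close> by auto
  hence "\<pi> dvd 1" using bpoly_unit_iff \<open>\<pi> \<noteq> 0\<close> by auto
  thus False using prime_elem_not_unit[OF assms] by simp
qed

definition prime_val :: "'a::field bpoly \<Rightarrow> 'a bpoly \<Rightarrow> int" where
  "prime_val \<pi> p = int (THE n. \<exists>q. p = \<pi> ^ n * q \<and> \<not> \<pi> dvd q)"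

text \<open>A prime has positive \<open>bsize\<close>, so splitting it off lowers
  \<open>bsize\<close> and must stop.\<close>

lemma prime_val_decompose:
  fixes \<pi> p :: "'a::field bpoly"
  assumes "prime_elem \<pi>" "p \<noteq> 0"
  obtains n q where "p = \<pi> ^ n * q" "\<not> \<pi> dvd q"
  using assms(2)
proof (induction "bsize p" arbitrary: p thesis rule: less_induct)
  case less
  show ?case
  proof (cases "\<pi> dvd p")
    case True
    then obtain r where r: "p = \<pi> * r" by (elim dvdE)
    hence nz: "\<pi> \<noteq> 0" "r \<noteq> 0" using less.prems by auto
    hence "bsize r < bsize p" using bsize_prime_pos[OF assms(1)] by (simp add: r bsize_mult)
    then obtain n q where "r = \<pi> ^ n * q" "\<not> \<pi> dvd q" using less.hyps nz by metis
    thus ?thesis using less.prems(1)[of "Suc n" q] by (simp add: r mult.assoc)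
  next
    case False
    thus ?thesis using less.prems(1)[of 0 p] by simp
  qed
qed

lemma prime_val_eq:
  fixes \<pi> q :: "'a::field bpoly"
  assumes "prime_elem \<pi>" "\<not> \<pi> dvd q"
  shows "prime_val \<pi> (\<pi> ^ n * q) = int n"
proof -
  have nz: "\<pi> \<noteq> 0" using assms(1) by auto
  have "m = n" if eq: "\<pi> ^ n * q = \<pi> ^ m * r" and r: "\<not> \<pi> dvd r" for m r
  proof (rule ccontr)
    assume "m \<noteq> n"
    then consider "m < n" | "n < m" by linarith
    thus False
    proof cases
      case 1
      hence "\<pi> ^ m * r = \<pi> ^ m * (\<pi> * (\<pi> ^ (n - m - 1) * q))"
        using eq by (simp flip: power_add power_Suc mult.assoc)
      thus False using r nz by simp
    next
      case 2
      hence "\<pi> ^ n * q = \<pi> ^ n * (\<pi> * (\<pi> ^ (m - n - 1) * r))"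
        using eq by (simp flip: power_add power_Suc mult.assoc)
      thus False using assms(2) nz by simp
    qed
  qed
  thus ?thesis unfolding prime_val_def
    using assms(2) by (subst the_equality[where a = n]) auto
qed

lemma prime_val_mult:
  assumes "prime_elem \<pi>" "p \<noteq> 0" "q \<noteq> 0"
  shows "prime_val \<pi> (p * q) = prime_val \<pi> p + prime_val \<pi> q"
proof -
  obtain n p' where p: "p = \<pi> ^ n * p'" "\<not> \<pi> dvd p'" by (rule prime_val_decompose[OF assms(1,2)])
  obtain m q' where q: "q = \<pi> ^ m * q'" "\<not> \<pi> dvd q'" by (rule prime_val_decompose[OF assms(1,3)])
  have "p * q = \<pi> ^ (n + m) * (p' * q')" by (simp add: p q power_add algebra_simps)
  moreover have "\<not> \<pi> dvd p' * q'" using p q assms(1) by (simp add: prime_elem_dvd_mult_iff)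
  ultimately show ?thesis using prime_val_eq[OF assms(1)] p q by (metis of_nat_add)
qed

lemma prime_val_ge_iff:
  assumes "prime_elem \<pi>" "p \<noteq> 0"
  shows "int k \<le> prime_val \<pi> p \<longleftrightarrow> \<pi> ^ k dvd p"
proof -
  have nz: "\<pi> \<noteq> 0" using assms(1) by auto
  obtain n q where p: "p = \<pi> ^ n * q" "\<not> \<pi> dvd q" by (rule prime_val_decompose[OF assms])
  have "\<pi> ^ k dvd p \<longleftrightarrow> k \<le> n"
  proof
    assume "k \<le> n"
    thus "\<pi> ^ k dvd p" by (simp add: p le_imp_power_dvd dvd_mult2)
  next
    assume "\<pi> ^ k dvd p"
    show "k \<le> n"
    proof (rule ccontr)
      assume "\<not> k \<le> n"
      hence "\<pi> ^ Suc n dvd p" using \<open>\<pi> ^ k dvd p\<close> by (metis dvd_trans le_imp_power_dvd not_less_eq_eq)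
      hence "\<pi> dvd q" using nz by (simp add: p)
      thus False using p by simp
    qed
  qed
  thus ?thesis using prime_val_eq[OF assms(1) p(2)] p by simp
qed

lemma prime_val_nonneg: "prime_elem \<pi> \<Longrightarrow> p \<noteq> 0 \<Longrightarrow> prime_val \<pi> p \<ge> 0"
  using prime_val_ge_iff[of \<pi> p 0] by simp

lemma prime_val_pos_iff: "prime_elem \<pi> \<Longrightarrow> p \<noteq> 0 \<Longrightarrow> prime_val \<pi> p \<ge> 1 \<longleftrightarrow> \<pi> dvd p"
  using prime_val_ge_iff[of \<pi> p 1] by simp

lemma valuation_prime:
  assumes "prime_elem \<pi>"
  shows "valuation (fract_val (prime_val \<pi>))"
proof (rule valuation_fract_val)
  show "prime_val \<pi> (p * q) = prime_val \<pi> p + prime_val \<pi> q" if "p \<noteq> 0" "q \<noteq> 0" for p q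
    using prime_val_mult[OF assms that] .
  show "min (prime_val \<pi> p) (prime_val \<pi> q) \<le> prime_val \<pi> (p + q)"
    if "p \<noteq> 0" "q \<noteq> 0" "p + q \<noteq> 0" for p q
  proof -
    define k where "k = nat (min (prime_val \<pi> p) (prime_val \<pi> q))"
    have k: "int k = min (prime_val \<pi> p) (prime_val \<pi> q)"
      using prime_val_nonneg[OF assms] that by (simp add: k_def)
    hence "\<pi> ^ k dvd p" "\<pi> ^ k dvd q"
      using prime_val_ge_iff[OF assms that(1), of k] prime_val_ge_iff[OF assms that(2), of k] by simp_all
    thus ?thesis using prime_val_ge_iff[OF assms that(3), of k] k by simp
  qed
  show "prime_val \<pi> (scal c) = 0" if "c \<noteq> 0" for c
  proof -
    have "scal c dvd 1" using that bpoly_unit_iff by blast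
    hence "\<not> \<pi> dvd scal c" using assms by (meson dvd_trans prime_elem_def)
    thus ?thesis using prime_val_eq[OF assms, of "scal c" 0] by simp
  qed
qed

lemma val_ge_prime_quotient:
  assumes "prime_elem \<pi>" "\<not> \<pi> dvd b"
  shows "val_ge (fract_val (prime_val \<pi>)) 0 (rat a / rat b)"
proof (cases "a = 0")
  case False
  have "b \<noteq> 0" using assms(2) by auto
  have "prime_val \<pi> b = 0" using prime_val_eq[OF assms, of 0] by simp
  thus ?thesis
    using fract_val_quotient[of "prime_val \<pi>" a b, OF prime_val_mult[OF assms(1)]] False
      \<open>b \<noteq> 0\<close> prime_val_nonneg[OF assms(1) False] by (simp add: val_ge_def)
qed (simp add: val_ge_def)

text \<open>The valuation ring is the localization of k[x,y] at \<pi>: the powers of \<pi> in the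
  denominator also divide the numerator and cancel.\<close>

lemma val_ge_prime_obtain:
  assumes "prime_elem \<pi>" "val_ge (fract_val (prime_val \<pi>)) 0 u"
  obtains a b where "\<not> \<pi> dvd b" "u = rat a / rat b"
proof (cases "u = 0")
  case True
  have "\<not> \<pi> dvd 1" using assms(1) by (rule prime_elem_not_unit)
  thus thesis using that[of 1 0] True by simp
next
  case False
  have nz: "\<pi> \<noteq> 0" using assms(1) by auto
  obtain a b where ab: "b \<noteq> 0" "u = rat a / rat b" by (rule fract_as_quotient)
  have "a \<noteq> 0" using False ab by auto
  obtain m b' where b: "b = \<pi> ^ m * b'" "\<not> \<pi> dvd b'" by (rule prime_val_decompose[OF assms(1) ab(1)])
  have "prime_val \<pi> b \<le> prime_val \<pi> a"
    using assms(2) False fract_val_quotient[of "prime_val \<pi>" a b, OF prime_val_mult[OF assms(1)]]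
      \<open>a \<noteq> 0\<close> ab by (simp add: val_ge_def)
  hence "int m \<le> prime_val \<pi> a" using prime_val_eq[OF assms(1) b(2)] b(1) by simp
  hence "\<pi> ^ m dvd a" using prime_val_ge_iff[OF assms(1) \<open>a \<noteq> 0\<close>] by simp
  then obtain a' where "a = \<pi> ^ m * a'" by (elim dvdE)
  hence "u = rat a' / rat b'" using nz by (simp add: ab b)
  thus thesis using that b(2) by blast
qed

text \<open>The localization at \<pi> is stable under both partial derivatives, since the quotient
  rule only squares the denominator and \<pi> does not divide the square.\<close>

lemma poisson_valuation_prime:
  assumes "prime_elem \<pi>"
  shows "poisson_valuation (rat g) (fract_val (prime_val \<pi>))"
proof (rule poisson_valuationI[OF valuation_prime[OF assms]])
  have "\<not> \<pi> dvd 1" using assms by (rule prime_elem_not_unit)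
  thus "val_ge (fract_val (prime_val \<pi>)) 0 (rat g)"
    using val_ge_prime_quotient[OF assms, of 1 g] by simp
next
  fix u
  assume "val_ge (fract_val (prime_val \<pi>)) 0 u"
  then obtain a b where ab: "\<not> \<pi> dvd b" "u = rat a / rat b"
    by (rule val_ge_prime_obtain[OF assms])
  have nz: "rat b \<noteq> 0" using ab(1) by auto
  have b2: "\<not> \<pi> dvd b ^ 2" using ab(1) assms by (simp add: prime_elem_dvd_power_iff)
  have "dx u = rat (poly_dx a * b - a * poly_dx b) / rat (b ^ 2)"
    "dy u = rat (poly_dy a * b - a * poly_dy b) / rat (b ^ 2)"
    by (simp_all add: ab derivation_divide[OF derivation_dx nz] derivation_divide[OF derivation_dy nz])
  thus "val_ge (fract_val (prime_val \<pi>)) 0 (dx u)" "val_ge (fract_val (prime_val \<pi>)) 0 (dy u)"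
    using val_ge_prime_quotient[OF assms b2] by metis+
qed

text \<open>Here factoriality of k[x,y] enters. A denominator that is not a unit has a prime factor;
  nonnegativity at this prime makes it divide the numerator, and cancelling it lowers
  \<open>bsize\<close>.\<close>

lemma range_rat_if_prime_vals_nonneg:
  fixes u :: "'a::field bpoly fract"
  assumes "\<And>\<pi>. prime_elem \<pi> \<Longrightarrow> val_ge (fract_val (prime_val \<pi>)) 0 u"
  shows "u \<in> range rat"
proof -
  have *: "\<exists>p. u = rat p" if "b \<noteq> 0" "u = rat a / rat b" for a b
    using that
  proof (induction "bsize b" arbitrary: a b rule: less_induct)
    case less
    show ?case
    proof (cases "b dvd 1")
      case True
      then obtain c where "1 = b * c" by (elim dvdE)
      hence "1 = rat b * rat c" by (simp flip: rat_mult)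
      hence "u = rat (a * c)" using less.prems by (simp add: divide_eq_eq mult_ac)
      thus ?thesis ..
    next
      case False
      then obtain F where F: "mset_factors F b" using mset_factors_exist less.prems by blast
      then obtain \<pi> where "\<pi> \<in># F" by (auto simp: mset_factors_def)
      hence \<pi>: "prime_elem \<pi>" "\<pi> dvd b"
        using F mset_factors_imp_dvd by (auto simp: mset_factors_def)
      have "\<pi> dvd a"
      proof (cases "a = 0")
        case False
        hence "u \<noteq> 0" using less.prems by simp
        hence "prime_val \<pi> b \<le> prime_val \<pi> a"
          using assms[OF \<pi>(1)] fract_val_quotient[of "prime_val \<pi>" a b, OF prime_val_mult[OF \<pi>(1)]]
            False less.prems by (simp add: val_ge_def)
        thus ?thesis
          using prime_val_pos_iff[OF \<pi>(1) less.prems(1)] prime_val_pos_iff[OF \<pi>(1) False] \<pi>(2) by simp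
      qed simp
      then obtain a' where a': "a = \<pi> * a'" by (elim dvdE)
      obtain b' where b': "b = \<pi> * b'" using \<pi>(2) by (elim dvdE)
      have nz: "\<pi> \<noteq> 0" "b' \<noteq> 0" using less.prems b' by auto
      hence "bsize b' < bsize b" using bsize_prime_pos[OF \<pi>(1)] by (simp add: b' bsize_mult)
      moreover have "u = rat a' / rat b'" using less.prems nz by (simp add: a' b')
      ultimately show ?thesis using less.hyps nz by blast
    qed
  qed
  obtain a b where "b \<noteq> 0" "u = rat a / rat b" by (rule fract_as_quotient)
  from *[OF this] show ?thesis by auto
qed

section \<open>The valuation at infinity\<close>

lemma degree_poly_dx: "degree (poly_dx p) \<le> degree p"
  unfolding poly_dx_def by (rule degree_map_poly_le)

lemma degree_poly_dy: "degree (poly_dy p) \<le> degree p"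
  using degree_pderiv_le[of p] by (simp add: poly_dy_def)

lemma minus_degree_mult:
  "p \<noteq> 0 \<Longrightarrow> q \<noteq> 0 \<Longrightarrow> - int (degree (p * q)) = - int (degree p) + - int (degree q)"
  for p q :: "'a::idom bpoly"
  by (simp add: degree_mult_eq)

lemma val_ge_degree_quotient:
  fixes a b :: "'a::field bpoly"
  assumes "b \<noteq> 0"
  shows "val_ge (fract_val (\<lambda>p. - int (degree p))) 0 (rat a / rat b) \<longleftrightarrow> degree a \<le> degree b"
proof (cases "a = 0")
  case False
  thus ?thesis
    using fract_val_quotient[of "\<lambda>p. - int (degree p)" a b, OF minus_degree_mult] assms
    by (simp add: val_ge_def)
qed (simp add: val_ge_def)

text \<open>\<open>degree\<close> is the degree in y alone, so this valuation is the order along the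
  divisor where y is infinite. Neither partial derivative raises that degree.\<close>

lemma poisson_valuation_degree:
  "poisson_valuation (1 :: 'a::field bpoly fract) (fract_val (\<lambda>p. - int (degree p)))"
proof (rule poisson_valuationI)
  show val: "valuation (fract_val (\<lambda>p::'a bpoly. - int (degree p)))"
  proof (rule valuation_fract_val)
    fix p q :: "'a bpoly"
    show "min (- int (degree p)) (- int (degree q)) \<le> - int (degree (p + q))"
      using degree_add_le_max[of p q] by linarith
  qed (simp_all add: minus_degree_mult scal_def)
  show "val_ge (fract_val (\<lambda>p::'a bpoly. - int (degree p))) 0 1"
    using valuation_1[OF val] by (simp add: val_ge_def)
next
  fix u :: "'a bpoly fract"
  assume u: "val_ge (fract_val (\<lambda>p. - int (degree p))) 0 u"
  obtain a b where ab: "b \<noteq> 0" "u = rat a / rat b" by (rule fract_as_quotient)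
  have deg: "degree a \<le> degree b" using u ab val_ge_degree_quotient[of b a] by simp
  have b2: "b ^ 2 \<noteq> 0" "degree (b ^ 2) = degree b + degree b"
    using ab(1) by (simp_all add: power2_eq_square degree_mult_eq)
  have nz: "rat b \<noteq> 0" using ab(1) by simp
  have u': "dx u = rat (poly_dx a * b - a * poly_dx b) / rat (b ^ 2)"
    "dy u = rat (poly_dy a * b - a * poly_dy b) / rat (b ^ 2)"
    unfolding ab(2) derivation_divide[OF derivation_dx nz] derivation_divide[OF derivation_dy nz]
    by simp_all
  have *: "degree (p * b - a * q) \<le> degree (b ^ 2)" if "degree p \<le> degree a" "degree q \<le> degree b" for p q
    unfolding b2 using that deg degree_mult_le[of p b] degree_mult_le[of a q]
    by (intro degree_diff_le) linarith+
  show "val_ge (fract_val (\<lambda>p. - int (degree p))) 0 (dx u)"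
    "val_ge (fract_val (\<lambda>p. - int (degree p))) 0 (dy u)"
    unfolding u' val_ge_degree_quotient[OF b2(1)]
    by (intro * degree_poly_dx degree_poly_dy)+
qed

section \<open>Polynomial substitutions\<close>

text \<open>Used twice, for the inner and then for the outer variable, this makes
  \<open>subst2\<close> a ring homomorphism.\<close>

lemma comm_ring_hom_eval:
  assumes "comm_ring_hom h"
  shows "comm_ring_hom (\<lambda>f. poly (map_poly h f) q)"
proof -
  interpret h: comm_ring_hom h by (rule assms)
  interpret map_poly_comm_ring_hom h ..
  show ?thesis by unfold_locales (simp_all add: hom_distribs)
qed

lemma comm_ring_hom_scal: "comm_ring_hom scal"
  by unfold_locales simp_all

lemma comm_ring_hom_subst2: "comm_ring_hom (\<lambda>f. subst2 f p q)"
  unfolding subst2_def by (intro comm_ring_hom_eval comm_ring_hom_scal)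

lemma subst2_add: "subst2 (f + g) p q = subst2 f p q + subst2 g p q"
  and subst2_mult: "subst2 (f * g) p q = subst2 f p q * subst2 g p q"
  and subst2_0: "subst2 0 p q = 0" and subst2_1: "subst2 1 p q = 1"
proof -
  interpret comm_ring_hom "\<lambda>f. subst2 f p q" by (rule comm_ring_hom_subst2)
  show "subst2 (f + g) p q = subst2 f p q + subst2 g p q"
    "subst2 (f * g) p q = subst2 f p q * subst2 g p q" "subst2 0 p q = 0" "subst2 1 p q = 1"
    by (simp_all add: hom_distribs)
qed

lemma subst2_scal: "subst2 (scal c) p q = scal c"
  by (cases "c = 0") (simp_all add: subst2_def scal_def map_poly_pCons)

lemma subst2_varX: "subst2 varX p q = p" and subst2_varY: "subst2 varY p q = q"
  by (simp_all add: subst2_def scal_def varX_def varY_def map_poly_pCons one_pCons[symmetric])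

lemmas subst2_simps = subst2_add subst2_mult subst2_0 subst2_1 subst2_scal subst2_varX subst2_varY

lemma subst2_prod: "subst2 (\<Prod>i\<in>A. h i) p q = (\<Prod>i\<in>A. subst2 (h i) p q)"
  by (induction A rule: infinite_finite_induct) (simp_all add: subst2_simps)

lemma subst2_affine_poly: "subst2 (affine_poly a b c) p q = scal a * p + scal b * q + scal c"
  by (simp add: affine_poly_def subst2_simps)

section \<open>Poisson isomorphisms\<close>

lemma poisson_field_isoD:
  assumes "poisson_field_iso f g \<phi>"
  shows "\<phi> (u + v) = \<phi> u + \<phi> v" "\<phi> (u * v) = \<phi> u * \<phi> v" "\<phi> (rat (scal c)) = rat (scal c)"
    "\<phi> (poisson_bracket f u v) = poisson_bracket g (\<phi> u) (\<phi> v)" "bij \<phi>"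
  using assms by (auto simp: poisson_field_iso_def)

lemma poisson_field_iso_0:
  assumes "poisson_field_iso f g \<phi>"
  shows "\<phi> u = 0 \<longleftrightarrow> u = 0"
  using poisson_field_isoD(3)[OF assms, of 0] poisson_field_isoD(5)[OF assms]
  by (auto dest: bij_is_inj simp: inj_eq) (metis bij_is_inj inj_eq)

lemma poisson_field_iso_inv:
  assumes "poisson_field_iso f g \<phi>"
  shows "poisson_field_iso g f (inv_into UNIV \<phi>)"
proof -
  note D = poisson_field_isoD[OF assms]
  have inj: "inj \<phi>" and inv: "\<phi> (inv_into UNIV \<phi> u) = u" for u
    using D(5) by (auto simp: bij_is_inj bij_is_surj surj_f_inv_f)
  show ?thesis
    unfolding poisson_field_iso_def
  proof (intro conjI allI)
    show "bij (inv_into UNIV \<phi>)" by (rule bij_imp_bij_inv[OF D(5)])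
  qed (rule injD[OF inj], simp add: D(1-4) inv)+
qed

text \<open>The definition refers only to field operations, constants and the bracket, all of which
  \<phi> respects. No control over the images of x and y is required.\<close>

lemma poisson_valuation_pullback:
  assumes "poisson_field_iso f g \<phi>" "poisson_valuation g v"
  shows "poisson_valuation f (v \<circ> \<phi>)"
proof -
  note D = poisson_field_isoD[OF assms(1)] and z = poisson_field_iso_0[OF assms(1)]
  have ge: "val_ge (v \<circ> \<phi>) k u \<longleftrightarrow> val_ge v k (\<phi> u)" for k u
    by (simp add: val_ge_def z)
  have val: "valuation v" using assms(2) by (simp add: poisson_valuation_def)
  have "\<phi> u + \<phi> w \<noteq> 0" if "u + w \<noteq> 0" for u w
    using z[of "u + w"] that by (simp add: D)
  hence "valuation (v \<circ> \<phi>)"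
    using val unfolding valuation_def by (simp add: D z)
  thus ?thesis
    using assms(2) unfolding poisson_valuation_def by (simp add: ge D)
qed

text \<open>The prime valuations of the target are pulled back to the source, where the bound on the
  coordinates holds. For the inverse map the two arrangements exchange roles.\<close>

lemma (in line_arrangement) poisson_iso_coordinates_polynomial:
  assumes "poisson_field_iso (rat (\<Prod>i<n. form i)) (rat g) \<phi>" "n > 0"
  obtains p q where "\<phi> (rat varX) = rat p" "\<phi> (rat varY) = rat q"
proof -
  have *: "val_ge (fract_val (prime_val \<pi>)) 0 (\<phi> (rat varX)) \<and>
      val_ge (fract_val (prime_val \<pi>)) 0 (\<phi> (rat varY))" if "prime_elem \<pi>" for \<pi>
    using poisson_valuation_coordinates_nonneg[OF poisson_valuation_pullback[OF assms(1)
        poisson_valuation_prime[OF that]] assms(2)]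
    by (simp add: val_ge_def)
  have "\<phi> (rat varX) \<in> range rat" "\<phi> (rat varY) \<in> range rat"
    by (rule range_rat_if_prime_vals_nonneg, erule conjunct1[OF *] conjunct2[OF *])+
  thus thesis using that by blast
qed

lemma poisson_iso_rat:
  assumes "poisson_field_iso f g \<phi>" "\<phi> (rat varX) = rat p" "\<phi> (rat varY) = rat q"
  shows "\<phi> (rat h) = rat (subst2 h p q)"
  by (induction h rule: bpoly_induct) (simp_all add: poisson_field_isoD[OF assms(1)] assms(2,3) subst2_simps)

section \<open>Affine changes of variables are Poisson isomorphisms\<close>

text \<open>The choice of representative is harmless when \<sigma> is multiplicative and vanishes
  only at 0.\<close>

definition fract_map :: "('a::field bpoly \<Rightarrow> 'a bpoly) \<Rightarrow> 'a bpoly fract \<Rightarrow> 'a bpoly fract" where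
  "fract_map \<sigma> u = (let (a, b) = (SOME (a, b). b \<noteq> 0 \<and> u = rat a / rat b) in rat (\<sigma> a) / rat (\<sigma> b))"

lemma fract_map_quotient:
  assumes mult: "\<And>p q. \<sigma> (p * q) = \<sigma> p * \<sigma> q" and zero: "\<And>p. \<sigma> p = 0 \<longleftrightarrow> p = 0" and b: "b \<noteq> 0"
  shows "fract_map \<sigma> (rat a / rat b) = rat (\<sigma> a) / rat (\<sigma> b)"
proof -
  obtain p q where pq: "(SOME (p, q). q \<noteq> 0 \<and> rat a / rat b = rat p / rat q) = (p, q)"
    by (rule prod.exhaust)
  have "case (p, q) of (p, q) \<Rightarrow> q \<noteq> 0 \<and> rat a / rat b = rat p / rat q"
    unfolding pq[symmetric] by (rule someI[of _ "(a, b)"]) (use b in simp)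
  hence q: "q \<noteq> 0" "a * q = p * b"
    using b by (auto simp: rat_divide_eq_iff)
  hence "\<sigma> a * \<sigma> q = \<sigma> p * \<sigma> b" by (metis mult)
  thus ?thesis using q b zero by (simp add: fract_map_def pq rat_divide_eq_iff)
qed

text \<open>By the chain rule an affine substitution multiplies Jacobians by its determinant
  \<open>D\<close>; the factor \<open>1 / D\<close> in \<open>affine_change\<close> compensates
  exactly this.\<close>

lemma affine_change_poisson_isomorphic:
  fixes C :: "'a::field^2^2"
  assumes "invertible C" "g = affine_change C c1 c2 f"
  shows "poisson_isomorphic (rat f) (rat g)"
proof -
  define c11 c12 c21 c22 where c: "c11 = C$1$1" "c12 = C$1$2" "c21 = C$2$1" "c22 = C$2$2"
  define D where "D = c11 * c22 - c12 * c21"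
  have D: "D \<noteq> 0" using assms(1) by (simp add: invertible_det_nz det_2 D_def c)
  define P where "P = affine_poly c11 c12 c1"
  define Q where "Q = affine_poly c21 c22 c2"
  \<comment> \<open>\<open>P'\<close> and \<open>Q'\<close> are the coordinates of the inverse
    affine map, read off from the adjugate matrix.\<close>
  define P' where "P' = affine_poly (c22 / D) (- c12 / D) ((c12 * c2 - c22 * c1) / D)"
  define Q' where "Q' = affine_poly (- c21 / D) (c11 / D) ((c21 * c1 - c11 * c2) / D)"
  define \<sigma> where "\<sigma> h = subst2 h P Q" for h
  define \<tau> where "\<tau> h = subst2 h P' Q'" for h
  note subst = subst2_simps[where p = P and q = Q, folded \<sigma>_def]
    subst2_simps[where p = P' and q = Q', folded \<tau>_def]
  have comb: "scal s * affine_poly p q r + scal t * affine_poly p' q' r' + scal w =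
      affine_poly (s * p + t * p') (s * q + t * q') (s * r + t * r' + w)" for s t p q r p' q' r' w :: 'a
    by (simp add: affine_poly_def algebra_simps)
  have XY: "varX = affine_poly 1 0 (0::'a)" "varY = affine_poly 0 1 (0::'a)"
    by (simp_all add: affine_poly_def)
  have "\<sigma> P' = varX" "\<sigma> Q' = varY" "\<tau> P = varX" "\<tau> Q = varY"
    unfolding \<sigma>_def \<tau>_def P_def Q_def P'_def Q'_def subst2_affine_poly comb unfolding XY
    using D by (intro arg_cong3[of _ _ _ _ _ _ affine_poly]; simp add: divide_simps; simp add: D_def algebra_simps)+
  hence \<sigma>\<tau>: "\<sigma> (\<tau> h) = h" and \<tau>\<sigma>: "\<tau> (\<sigma> h) = h" for h
    by (induction h rule: bpoly_induct) (simp_all add: subst)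
  have \<sigma>0: "\<sigma> h = 0 \<longleftrightarrow> h = 0" and \<tau>0: "\<tau> h = 0 \<longleftrightarrow> h = 0" for h
    using \<sigma>\<tau>[of h] \<tau>\<sigma>[of h] subst by metis+
  define \<phi> where "\<phi> = fract_map \<sigma>"
  define \<psi> where "\<psi> = fract_map \<tau>"
  have \<phi>: "\<phi> (rat a / rat b) = rat (\<sigma> a) / rat (\<sigma> b)"
    and \<psi>: "\<psi> (rat a / rat b) = rat (\<tau> a) / rat (\<tau> b)" if "b \<noteq> 0" for a b
    unfolding \<phi>_def \<psi>_def by (rule fract_map_quotient; simp add: subst \<sigma>0 \<tau>0 that)+
  have \<phi>_rat: "\<phi> (rat a) = rat (\<sigma> a)" for a
    using \<phi>[of 1 a] by (simp add: subst)
  have "\<psi> (\<phi> u) = u" for u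
    by (rule fract_as_quotient[of u]) (simp add: \<phi> \<psi> \<sigma>0 \<tau>\<sigma>)
  moreover have "\<phi> (\<psi> u) = u" for u
    by (rule fract_as_quotient[of u]) (simp add: \<phi> \<psi> \<tau>0 \<sigma>\<tau>)
  ultimately have bij: "bij \<phi>" by (intro o_bij[of \<psi>]) auto
  have add: "\<phi> (u + v) = \<phi> u + \<phi> v" and mult: "\<phi> (u * v) = \<phi> u * \<phi> v" for u v
  proof -
    obtain a b where ab: "b \<noteq> 0" "u = rat a / rat b" by (rule fract_as_quotient)
    obtain a' b' where ab': "b' \<noteq> 0" "v = rat a' / rat b'" by (rule fract_as_quotient)
    have s: "u + v = rat (a * b' + a' * b) / rat (b * b')"
      unfolding ab(2) ab'(2) rat_add rat_mult by (rule add_frac_eq) (use ab ab' in auto)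
    have "\<phi> u + \<phi> v = rat (\<sigma> (a * b' + a' * b)) / rat (\<sigma> (b * b'))"
      unfolding ab(2) ab'(2) \<phi>[OF ab(1)] \<phi>[OF ab'(1)] subst rat_add rat_mult
      by (rule add_frac_eq) (use ab ab' \<sigma>0 in auto)
    thus "\<phi> (u + v) = \<phi> u + \<phi> v"
      unfolding s using ab(1) ab'(1) by (subst \<phi>) auto
    have "u * v = rat (a * a') / rat (b * b')" by (simp add: ab ab')
    thus "\<phi> (u * v) = \<phi> u * \<phi> v"
      using \<phi>[of "b * b'" "a * a'"] ab(1) ab'(1) by (simp add: ab(2) ab'(2) \<phi> subst)
  qed
  \<comment> \<open>The chain rule on polynomials. Both sides are additive and obey the same Leibniz
    rule along \<sigma>, so the generators decide.\<close>
  have deriv_poly: "poly_dx (\<sigma> h) = scal c11 * \<sigma> (poly_dx h) + scal c21 * \<sigma> (poly_dy h)"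
    "poly_dy (\<sigma> h) = scal c12 * \<sigma> (poly_dx h) + scal c22 * \<sigma> (poly_dy h)" for h
  proof (induction h rule: bpoly_induct)
    case X
    show "poly_dx (\<sigma> varX) = scal c11 * \<sigma> (poly_dx varX) + scal c21 * \<sigma> (poly_dy varX)"
      "poly_dy (\<sigma> varX) = scal c12 * \<sigma> (poly_dx varX) + scal c22 * \<sigma> (poly_dy varX)"
      by (simp_all add: subst P_def affine_poly_def poly_dx_add poly_dx_mult poly_dy_add poly_dy_mult)
  next
    case Y
    show "poly_dx (\<sigma> varY) = scal c11 * \<sigma> (poly_dx varY) + scal c21 * \<sigma> (poly_dy varY)"
      "poly_dy (\<sigma> varY) = scal c12 * \<sigma> (poly_dx varY) + scal c22 * \<sigma> (poly_dy varY)"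
      by (simp_all add: subst Q_def affine_poly_def poly_dx_add poly_dx_mult poly_dy_add poly_dy_mult)
  qed (simp_all add: subst poly_dx_add poly_dx_mult poly_dy_add poly_dy_mult algebra_simps)
  have deriv: "dx (\<phi> u) = rat (scal c11) * \<phi> (dx u) + rat (scal c21) * \<phi> (dy u)"
    "dy (\<phi> u) = rat (scal c12) * \<phi> (dx u) + rat (scal c22) * \<phi> (dy u)" for u
  proof -
    obtain a b where ab: "b \<noteq> 0" "u = rat a / rat b" by (rule fract_as_quotient)
    have nz: "rat b \<noteq> 0" "rat (\<sigma> b) \<noteq> 0" "b ^ 2 \<noteq> 0" using ab(1) \<sigma>0 by auto
    have sub: "\<sigma> (p - q) = \<sigma> p - \<sigma> q" for p q
      using subst(1)[of "p - q" q] by simp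
    have u: "dx u = rat (poly_dx a * b - a * poly_dx b) / rat (b ^ 2)"
      "dy u = rat (poly_dy a * b - a * poly_dy b) / rat (b ^ 2)"
      unfolding ab(2) derivation_divide[OF derivation_dx nz(1)] derivation_divide[OF derivation_dy nz(1)]
      by simp_all
    have u': "\<phi> (dx u) = rat (\<sigma> (poly_dx a) * \<sigma> b - \<sigma> a * \<sigma> (poly_dx b)) / rat (\<sigma> b) ^ 2"
      "\<phi> (dy u) = rat (\<sigma> (poly_dy a) * \<sigma> b - \<sigma> a * \<sigma> (poly_dy b)) / rat (\<sigma> b) ^ 2"
      unfolding u \<phi>[OF nz(3)] by (simp_all add: sub subst power2_eq_square)
    have "dx (\<phi> u) = rat (poly_dx (\<sigma> a) * \<sigma> b - \<sigma> a * poly_dx (\<sigma> b)) / rat (\<sigma> b) ^ 2"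
      "dy (\<phi> u) = rat (poly_dy (\<sigma> a) * \<sigma> b - \<sigma> a * poly_dy (\<sigma> b)) / rat (\<sigma> b) ^ 2"
      unfolding ab(2) \<phi>[OF ab(1)] derivation_divide[OF derivation_dx nz(2)]
        derivation_divide[OF derivation_dy nz(2)]
      by simp_all
    moreover have "rat (scal s) * (rat h / w) + rat (scal t) * (rat k / w) =
        rat (scal s * h + scal t * k) / w" for s t h k and w :: "'a bpoly fract"
      by (simp add: add_divide_distrib)
    ultimately show "dx (\<phi> u) = rat (scal c11) * \<phi> (dx u) + rat (scal c21) * \<phi> (dy u)"
      "dy (\<phi> u) = rat (scal c12) * \<phi> (dx u) + rat (scal c22) * \<phi> (dy u)"
      unfolding u' deriv_poly
      by (simp_all only:) (intro arg_cong2[of _ _ _ _ "(/)"] arg_cong[of _ _ rat]; simp add: algebra_simps)+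
  qed
  have "g = scal (1 / D) * \<sigma> f"
    by (simp add: assms(2) affine_change_def D_def \<sigma>_def P_def Q_def c)
  hence "scal D * g = \<sigma> f"
    using D by (simp flip: scal_mult mult.assoc)
  hence gf: "rat (scal D) * rat g = \<phi> (rat f)"
    by (simp add: \<phi>_rat flip: rat_mult)
  have sub: "\<phi> (u - v) = \<phi> u - \<phi> v" for u v
    using add[of "u - v" v] by simp
  have "\<phi> (poisson_bracket (rat f) u v) = poisson_bracket (rat g) (\<phi> u) (\<phi> v)" for u v
  proof -
    \<comment> \<open>Expanding by \<open>deriv\<close>, the mixed products combine to the
      determinant \<open>D\<close>, which \<open>gf\<close> then absorbs.\<close>
    have "poisson_bracket (rat g) (\<phi> u) (\<phi> v) =
        rat (scal D) * (\<phi> (dx u) * \<phi> (dy v) - \<phi> (dy u) * \<phi> (dx v)) * rat g"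
      unfolding poisson_bracket_def deriv D_def by (simp add: algebra_simps)
    also have "\<dots> = (\<phi> (dx u) * \<phi> (dy v) - \<phi> (dy u) * \<phi> (dx v)) * \<phi> (rat f)"
      unfolding gf[symmetric] by (simp add: algebra_simps)
    finally show ?thesis by (simp add: poisson_bracket_def sub mult)
  qed
  hence "poisson_field_iso (rat f) (rat g) \<phi>"
    unfolding poisson_field_iso_def using bij add mult by (simp add: \<phi>_rat subst)
  thus ?thesis by (auto simp: poisson_isomorphic_def)
qed

section \<open>Poisson isomorphisms between line arrangements\<close>

lemma poisson_bracket_rat:
  "poisson_bracket (rat f) (rat p) (rat q) = rat ((poly_dx p * poly_dy q - poly_dy p * poly_dx q) * f)"
  by (simp add: poisson_bracket_def)

text \<open>By additivity one of two factors has \<open>bsize\<close> 0, hence is a unit.\<close>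

lemma irreducible_bsize_1:
  fixes l :: "'a::field bpoly"
  assumes "bsize l = 1" "l \<noteq> 0"
  shows "irreducible l"
proof (rule irreducibleI)
  show "\<not> l dvd 1" using assms bpoly_unit_iff[of l] bsize_eq_0_iff[of l] by auto
  fix p q
  assume l: "l = p * q"
  hence nz: "p \<noteq> 0" "q \<noteq> 0" using assms(2) by auto
  hence "bsize p = 0 \<or> bsize q = 0" using assms(1) unfolding l bsize_mult[OF nz] by linarith
  thus "p dvd 1 \<or> q dvd 1"
    using nz bsize_eq_0_iff[of p] bsize_eq_0_iff[of q] bpoly_unit_iff[of p] bpoly_unit_iff[of q] by auto
qed (fact assms(2))

lemma prime_elem_dvd_prodD:
  fixes h :: "'i \<Rightarrow> 'b::comm_semiring_1"
  assumes "prime_elem \<pi>" "\<pi> dvd (\<Prod>i\<in>A. h i)"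
  shows "\<exists>i\<in>A. \<pi> dvd h i"
  using assms(2)
proof (induction A rule: infinite_finite_induct)
  case (insert i A)
  thus ?case using assms(1) by (auto simp del: prime_elem_iff_irreducible dest: prime_elem_dvd_multD)
qed (use prime_elem_not_unit[OF assms(1)] in simp_all)

context line_arrangement
begin

lemma irreducible_form:
  assumes "i < n"
  shows "irreducible (form i)"
proof (rule irreducible_bsize_1[OF _ form_neq_0[OF assms]])
  have "form i = [:[:c i, a i:], [:b i:]:]"
    by (simp add: form_def affine_poly_def scal_def varX_def varY_def)
  thus "bsize (form i) = 1"
    using nonconst[OF assms] by (auto simp: bsize_def)
qed

text \<open>
  Over the bracket \<open>{x,y} = 1\<close> the line at infinity is also a Poisson valuation, so its polynomial
  coordinates would be constant in \<open>y\<close>.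
\<close>

lemma not_poisson_isomorphic_1:
  assumes "n > 0" "poisson_field_iso (rat (\<Prod>i<n. form i)) (rat 1) \<phi>"
  shows False
proof -
  obtain p q where pq: "\<phi> (rat varX) = rat p" "\<phi> (rat varY) = rat q"
    using poisson_iso_coordinates_polynomial[OF assms(2,1)] .
  have iso1: "poisson_field_iso (rat (\<Prod>i<n. form i)) 1 \<phi>" using assms(2) by simp
  note nonneg = poisson_valuation_coordinates_nonneg[OF poisson_valuation_pullback[OF iso1
      poisson_valuation_degree] assms(1)]
  have "degree p = 0" "degree q = 0"
    using nonneg val_ge_degree_quotient[of 1 p] val_ge_degree_quotient[of 1 q]
    by (simp_all add: pq val_ge_def)
  hence "poly_dy p = 0" "poly_dy q = 0"
    by (auto simp: poly_dy_def pderiv_eq_0_iff)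
  moreover have "\<phi> (rat (\<Prod>i<n. form i)) = poisson_bracket (rat 1) (rat p) (rat q)"
    using poisson_field_isoD(4)[OF assms(2), of "rat varX" "rat varY"]
    by (simp only: poisson_bracket_xy pq)
  ultimately have "\<phi> (rat (\<Prod>i<n. form i)) = 0"
    by (simp only: poisson_bracket_rat) simp
  hence "(\<Prod>i<n. form i) = 0" using poisson_field_iso_0[OF assms(2)] by simp
  thus False using form_neq_0 by simp
qed

lemma ex_nonparallel:
  assumes "i < n"
  obtains j where "j < n" "a i * b j - a j * b i \<noteq> 0"
proof -
  have "{j. j < n \<and> a i * b j - a j * b i \<noteq> 0} \<noteq> {}"
    using three[OF assms] by (metis card.empty not_numeral_le_zero)
  thus thesis using that by blast
qed

end

section \<open>The polynomial automorphism induced by a Poisson isomorphism is affine\<close>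

lemma affine_poly_comb:
  "scal s * affine_poly p q r + scal t * affine_poly p' q' r' + scal w =
    affine_poly (s * p + t * p') (s * q + t * q') (s * r + t * r' + w)"
  by (simp add: affine_poly_def algebra_simps)

text \<open>The isomorphism and its inverse are mutually inverse substitutions \<sigma> and \<tau>.
  Applying \<sigma> to {x,y} = f gives \<open>\<sigma> f = J * g\<close> with the Jacobian
  \<open>J\<close>, and \<open>J\<close> is a unit. So \<sigma> maps each line of f to a multiple of
  a line of g, and two crossing lines determine \<sigma>. The last conclusion serves the homogeneous
  case, where no translation may appear.\<close>

lemma poisson_isomorphic_arrangements:
  fixes a b c a' b' c' :: "nat \<Rightarrow> 'a::field_char_0"
  assumes F: "line_arrangement n a b c" and G: "line_arrangement n' a' b' c'" and pos: "n > 0" "n' > 0"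
    and f: "f = (\<Prod>i<n. affine_poly (a i) (b i) (c i))"
    and g: "g = (\<Prod>i<n'. affine_poly (a' i) (b' i) (c' i))"
    and iso: "poisson_isomorphic (rat f) (rat g)"
  obtains C :: "'a^2^2" and c1 c2 where "invertible C" "g = affine_change C c1 c2 f"
    "(\<forall>i<n. c i = 0) \<and> (\<forall>j<n'. c' j = 0) \<longrightarrow> c1 = 0 \<and> c2 = 0"
proof -
  interpret F: line_arrangement n a b c by (rule F)
  interpret G: line_arrangement n' a' b' c' by (rule G)
  have f': "f = (\<Prod>i<n. F.form i)" and g': "g = (\<Prod>i<n'. G.form i)"
    by (simp_all add: f g F.form_def G.form_def)
  have fg0: "f \<noteq> 0" "g \<noteq> 0" using F.form_neq_0 G.form_neq_0 by (simp_all add: f' g')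
  obtain \<phi> where \<phi>: "poisson_field_iso (rat f) (rat g) \<phi>"
    using iso by (auto simp: poisson_isomorphic_def)
  define \<psi> where "\<psi> = inv_into UNIV \<phi>"
  have \<psi>: "poisson_field_iso (rat g) (rat f) \<psi>"
    unfolding \<psi>_def by (rule poisson_field_iso_inv[OF \<phi>])
  have bij: "bij \<phi>" by (rule poisson_field_isoD(5)[OF \<phi>])
  obtain p q where pq: "\<phi> (rat varX) = rat p" "\<phi> (rat varY) = rat q"
    using F.poisson_iso_coordinates_polynomial[OF \<phi>[unfolded f'] pos(1)] .
  obtain p' q' where pq': "\<psi> (rat varX) = rat p'" "\<psi> (rat varY) = rat q'"
    using G.poisson_iso_coordinates_polynomial[OF \<psi>[unfolded g'] pos(2)] .
  define \<sigma> where "\<sigma> h = subst2 h p q" for h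
  define \<tau> where "\<tau> h = subst2 h p' q'" for h
  note subst = subst2_simps[where p = p and q = q, folded \<sigma>_def]
    subst2_simps[where p = p' and q = q', folded \<tau>_def]
  have \<phi>_rat: "\<phi> (rat h) = rat (\<sigma> h)" and \<psi>_rat: "\<psi> (rat h) = rat (\<tau> h)" for h
    unfolding \<sigma>_def \<tau>_def by (rule poisson_iso_rat[OF \<phi> pq] poisson_iso_rat[OF \<psi> pq'])+
  have "rat (\<sigma> (\<tau> h)) = rat h" "rat (\<tau> (\<sigma> h)) = rat h" for h
    unfolding \<phi>_rat[symmetric] \<psi>_rat[symmetric] \<psi>_def
    using bij by (simp_all add: bij_is_surj surj_f_inv_f bij_is_inj inv_f_f)
  hence \<sigma>\<tau>: "\<sigma> (\<tau> h) = h" and \<tau>\<sigma>: "\<tau> (\<sigma> h) = h" for h by simp_all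
  define J where "J = poly_dx p * poly_dy q - poly_dy p * poly_dx q"
  define J' where "J' = poly_dx p' * poly_dy q' - poly_dy p' * poly_dx q'"
  have "rat (\<sigma> f) = rat (J * g)"
    using poisson_field_isoD(4)[OF \<phi>, of "rat varX" "rat varY"]
    unfolding poisson_bracket_xy pq poisson_bracket_rat J_def \<phi>_rat[of f] .
  hence \<sigma>f: "\<sigma> f = J * g" by (simp only: rat_eq_iff)
  have "rat (\<tau> g) = rat (J' * f)"
    using poisson_field_isoD(4)[OF \<psi>, of "rat varX" "rat varY"]
    unfolding poisson_bracket_xy pq' poisson_bracket_rat J'_def \<psi>_rat[of g] .
  hence \<tau>g: "\<tau> g = J' * f" by (simp only: rat_eq_iff)
  \<comment> \<open>Applying \<sigma> to \<open>\<tau> g = J' * f\<close> returns g, and cancelling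
    g exhibits an inverse of \<open>J\<close>.\<close>
  have "1 * g = (\<sigma> J' * J) * g"
    using \<sigma>\<tau>[of g] by (simp add: \<tau>g subst \<sigma>f mult.assoc)
  hence "1 = J * \<sigma> J'" using fg0 by (simp only: mult_cancel_right) (simp add: mult.commute)
  hence "J dvd 1" by (rule dvdI)
  then obtain D where D: "D \<noteq> 0" "J = scal D" by (auto simp: bpoly_unit_iff)
  have unit: "h dvd 1" if "\<tau> h dvd 1" for h
  proof -
    obtain k where "1 = \<tau> h * k" using \<open>\<tau> h dvd 1\<close> by (elim dvdE)
    hence "\<sigma> 1 = h * \<sigma> k" by (metis subst(2) \<sigma>\<tau>)
    thus ?thesis by (simp add: subst dvdI)
  qed
  have irred: "irreducible (\<sigma> h)" if "irreducible h" for h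
  proof (rule irreducibleI)
    have "h \<noteq> 0" "\<not> h dvd 1" using that by (auto simp: irreducible_def)
    show "\<sigma> h \<noteq> 0" using \<open>h \<noteq> 0\<close> \<tau>\<sigma>[of h] subst by metis
    show "\<not> \<sigma> h dvd 1"
    proof
      assume "\<sigma> h dvd 1"
      then obtain k where "1 = \<sigma> h * k" by (elim dvdE)
      hence "1 = h * \<tau> k" by (metis subst(9) subst(11) \<tau>\<sigma>)
      thus False using \<open>\<not> h dvd 1\<close> by (simp add: dvdI)
    qed
    fix u v
    assume "\<sigma> h = u * v"
    hence "h = \<tau> u * \<tau> v" by (metis subst(9) \<tau>\<sigma>)
    hence "\<tau> u dvd 1 \<or> \<tau> v dvd 1" using that by (auto simp: irreducible_def)
    thus "u dvd 1 \<or> v dvd 1" using unit by blast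
  qed
  have lines: "\<exists>j s. j < n' \<and> \<sigma> (F.form i) = scal s * G.form j" if i: "i < n" for i
  proof -
    \<comment> \<open>Automorphisms preserve irreducibility, and in a factorial ring irreducible
      elements are prime. This image divides \<open>scal D * g\<close>, hence a single line of
      g.\<close>
    have prime: "prime_elem (\<sigma> (F.form i))"
      using irred[OF F.irreducible_form[OF i]] by simp
    have "\<sigma> (F.form i) dvd \<sigma> f"
      using i unfolding f' \<sigma>_def subst2_prod by (intro dvd_prodI) auto
    hence "\<sigma> (F.form i) dvd scal D \<or> \<sigma> (F.form i) dvd (\<Prod>j<n'. G.form j)"
      using prime by (simp only: \<sigma>f D(2) g' prime_elem_dvd_mult_iff)
    moreover have "\<not> \<sigma> (F.form i) dvd scal D"
      using prime_elem_not_unit[OF prime] bpoly_unit_iff[of "scal D"] D(1) dvd_trans by blast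
    ultimately obtain j where j: "j < n'" "\<sigma> (F.form i) dvd G.form j"
      using prime_elem_dvd_prodD[OF prime] by blast
    then obtain r where r: "G.form j = \<sigma> (F.form i) * r" by (elim dvdE)
    have "r dvd 1"
      using irreducibleD[OF G.irreducible_form[OF j(1)] r] prime_elem_not_unit[OF prime] by simp
    then obtain t where t: "t \<noteq> 0" "r = scal t" by (auto simp: bpoly_unit_iff)
    have "\<sigma> (F.form i) = scal (1 / t) * G.form j"
      using t by (simp add: r mult.left_commute[of "scal (1 / t)"] flip: scal_mult)
    thus ?thesis using j by blast
  qed
  obtain j where j: "j < n" "a 0 * b j - a j * b 0 \<noteq> 0" by (rule F.ex_nonparallel[OF pos(1)])
  obtain k s where k: "k < n'" "\<sigma> (F.form 0) = scal s * G.form k" using lines[OF pos(1)] by blast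
  obtain l t where l: "l < n'" "\<sigma> (F.form j) = scal t * G.form l" using lines[OF j(1)] by blast
  \<comment> \<open>Tracks constant terms: when all lines pass through the origin, Cramer's rule has
    no constant term, and neither do the images of x and y.\<close>
  define homog where "homog \<longleftrightarrow> (\<forall>i<n. c i = 0) \<and> (\<forall>j<n'. c' j = 0)"
  have affine: "\<exists>x y z. \<sigma> h = affine_poly x y z \<and> (homog \<longrightarrow> z = 0)"
    if h: "h = scal \<alpha> * F.form 0 + scal \<beta> * F.form j + scal \<gamma>" and "homog \<longrightarrow> \<gamma> = 0" for h \<alpha> \<beta> \<gamma>
  proof -
    have "\<sigma> h = scal (\<alpha> * s) * G.form k + scal (\<beta> * t) * G.form l + scal \<gamma>"
      by (simp add: h subst k l mult.assoc)
    moreover have "homog \<longrightarrow> \<alpha> * s * c' k + \<beta> * t * c' l + \<gamma> = 0"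
      using that(2) k(1) l(1) by (simp add: homog_def)
    ultimately show ?thesis unfolding G.form_def affine_poly_comb by metis
  qed
  note coords = F.coordinates_from_forms[OF j(2)]
  have "\<exists>x y z. \<sigma> varX = affine_poly x y z \<and> (homog \<longrightarrow> z = 0)"
    by (rule affine[OF coords(1)]) (use pos j(1) in \<open>simp add: homog_def\<close>)
  then obtain c11 c12 c1 where p: "p = affine_poly c11 c12 c1" and c1: "homog \<longrightarrow> c1 = 0"
    by (auto simp: subst)
  have "\<exists>x y z. \<sigma> varY = affine_poly x y z \<and> (homog \<longrightarrow> z = 0)"
    by (rule affine[OF coords(2)]) (use pos j(1) in \<open>simp add: homog_def\<close>)
  then obtain c21 c22 c2 where q: "q = affine_poly c21 c22 c2" and c2: "homog \<longrightarrow> c2 = 0"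
    by (auto simp: subst)
  define C :: "'a^2^2" where "C = vector [vector [c11, c12], vector [c21, c22]]"
  have C: "C$1$1 = c11" "C$1$2 = c12" "C$2$1 = c21" "C$2$2 = c22"
    by (simp_all add: C_def)
  \<comment> \<open>The Jacobian of an affine substitution is its determinant, so the unit
    \<open>J\<close> makes the matrix invertible.\<close>
  have "J = scal (c11 * c22 - c12 * c21)"
    unfolding J_def p q
    by (simp add: affine_poly_def poly_dx_add poly_dx_mult poly_dy_add poly_dy_mult)
  hence det: "c11 * c22 - c12 * c21 = D" using D(2) by (simp only: scal_eq_iff)
  have inv: "invertible C"
    unfolding invertible_det_nz det_2 C det by (rule D(1))
  have "affine_change C c1 c2 f = scal (1 / D) * (scal D * g)"
    unfolding affine_change_def C det p[symmetric] q[symmetric] \<sigma>_def[symmetric] \<sigma>f D(2) ..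
  hence "g = affine_change C c1 c2 f"
    using D(1) by (simp flip: scal_mult mult.assoc)
  thus thesis using that inv c1 c2 unfolding homog_def by blast
qed

text \<open>If the determinant vanished, one derivation would kill both forms. Its kernel is a
  subalgebra, so it would contain x and y, which forces a = b = 0.\<close>

lemma generates_algebra_affine:
  fixes a b :: "'a::idom"
  assumes "generates_algebra {affine_poly a b c, affine_poly a' b' c'}" "a \<noteq> 0 \<or> b \<noteq> 0"
  shows "a * b' - a' * b \<noteq> 0"
proof
  assume det: "a * b' - a' * b = 0"
  \<comment> \<open>The kernel of the derivation along the common direction of the two lines.\<close>
  define V where "V = {p. scal b * poly_dx p = scal a * poly_dy p}"
  have "is_subalgebra V"
    unfolding is_subalgebra_def V_def
  proof (intro conjI ballI allI CollectI; (elim CollectE)?)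
    fix p q :: "'a bpoly"
    assume p: "scal b * poly_dx p = scal a * poly_dy p" and q: "scal b * poly_dx q = scal a * poly_dy q"
    show "scal b * poly_dx (p + q) = scal a * poly_dy (p + q)"
      by (simp add: poly_dx_add poly_dy_add distrib_left p q)
    have "scal b * poly_dx (p * q) = p * (scal b * poly_dx q) + q * (scal b * poly_dx p)"
      by (simp add: poly_dx_mult algebra_simps)
    also have "\<dots> = scal a * poly_dy (p * q)"
      unfolding p q by (simp add: poly_dy_mult algebra_simps)
    finally show "scal b * poly_dx (p * q) = scal a * poly_dy (p * q)" .
  qed simp
  moreover have "scal b * scal a' = scal a * scal b'"
    using det by (simp add: mult.commute flip: scal_mult)
  hence "{affine_poly a b c, affine_poly a' b' c'} \<subseteq> V"
    by (simp add: V_def affine_poly_def poly_dx_add poly_dx_mult poly_dy_add poly_dy_mult mult.commute)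
  ultimately have "is_subalgebra hull {affine_poly a b c, affine_poly a' b' c'} \<subseteq> V"
    by (intro hull_minimal)
  hence "varX \<in> V" "varY \<in> V" using assms(1) by (auto simp: generates_algebra_def)
  thus False using assms(2) by (simp add: V_def)
qed

text \<open>Generating pairs are not parallel, so the count in (G) bounds the determinant count from
  below.\<close>

lemma condition_G_arrangement:
  fixes f :: "'a::field_char_0 bpoly"
  assumes "condition_G f"
  obtains n a b c where "line_arrangement n a b c" "f = (\<Prod>i<n. affine_poly (a i) (b i) (c i))"
proof -
  obtain n l where l: "linear_factorization n l f"
    "\<And>i. i < n \<Longrightarrow> card {j. j < n \<and> generates_algebra {l i, l j}} \<ge> 3"
    using assms by (auto simp: condition_G_def)
  have "\<forall>i. \<exists>a b c. i < n \<longrightarrow> l i = affine_poly a b c"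
    using l(1) unfolding linear_factorization_def linear_form_def by metis
  then obtain a b c where abc: "\<And>i. i < n \<Longrightarrow> l i = affine_poly (a i) (b i) (c i)" by metis
  have nonconst: "a i \<noteq> 0 \<or> b i \<noteq> 0" if "i < n" for i
  proof -
    have "l i \<notin> range scal" using l(1) that by (simp add: linear_factorization_def linear_form_def)
    thus ?thesis using abc[OF that] by (simp add: affine_poly_in_range_scal_iff)
  qed
  have "line_arrangement n a b c"
  proof
    show "distinct_up_to_scalars n (\<lambda>i. affine_poly (a i) (b i) (c i))"
      using l(1) abc unfolding linear_factorization_def distinct_up_to_scalars_def by metis
    fix i
    assume i: "i < n"
    have "{j. j < n \<and> generates_algebra {l i, l j}} \<subseteq> {j. j < n \<and> a i * b j - a j * b i \<noteq> 0}"
      using generates_algebra_affine[OF _ nonconst[OF i]] abc[OF i] abc by auto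
    hence "card {j. j < n \<and> generates_algebra {l i, l j}} \<le> card {j. j < n \<and> a i * b j - a j * b i \<noteq> 0}"
      by (intro card_mono) auto
    thus "3 \<le> card {j. j < n \<and> a i * b j - a j * b i \<noteq> 0}" using l(2)[OF i] by simp
  qed (rule nonconst)
  moreover have "f = (\<Prod>i<n. affine_poly (a i) (b i) (c i))"
    using l(1) abc by (simp add: linear_factorization_def)
  ultimately show thesis using that by blast
qed

text \<open>Distinct lines through the origin are never parallel. Each line is therefore crossed by
  all n - 1 others, and four lines give the required three.\<close>

lemma four_homogeneous_forms_arrangement:
  fixes f :: "'a::field_char_0 bpoly"
  assumes "product_of_four_or_more_homogeneous_forms f"
  obtains n a b where "line_arrangement n a b (\<lambda>_. 0)" "n > 0"
    "f = (\<Prod>i<n. affine_poly (a i) (b i) 0)"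
proof -
  obtain n l where n: "n \<ge> 4" and f: "f = (\<Prod>i<n. l i)"
    and l: "\<And>i. i < n \<Longrightarrow> homogeneous_linear_form (l i)" "distinct_up_to_scalars n l"
    using assms by (auto simp: product_of_four_or_more_homogeneous_forms_def)
  have "\<forall>i. \<exists>a b. i < n \<longrightarrow> l i = affine_poly a b 0"
    using l(1) unfolding homogeneous_linear_form_def by metis
  then obtain a b where ab: "\<And>i. i < n \<Longrightarrow> l i = affine_poly (a i) (b i) 0" by metis
  have nonconst: "a i \<noteq> 0 \<or> b i \<noteq> 0" if "i < n" for i
    using l(1)[OF that] ab[OF that] by (simp add: homogeneous_linear_form_def affine_poly_eq_0_iff)
  have nonparallel: "a i * b j - a j * b i \<noteq> 0" if "i < n" "j < n" "i \<noteq> j" for i j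
  proof
    assume det: "a i * b j - a j * b i = 0"
    have nj: "a j \<noteq> 0 \<or> b j \<noteq> 0" using that(2) by (rule nonconst)
    obtain s where s: "a i = s * a j" "b i = s * b j"
      using proportional_pairs[OF _ nj, of "a i" "b i"] det by auto
    hence "s \<noteq> 0" using nonconst[OF that(1)] by auto
    moreover have "l i = scal s * l j"
      by (simp add: ab that s affine_poly_def algebra_simps)
    ultimately show False using l(2) that unfolding distinct_up_to_scalars_def by blast
  qed
  have "line_arrangement n a b (\<lambda>_. 0)"
  proof
    show "distinct_up_to_scalars n (\<lambda>i. affine_poly (a i) (b i) 0)"
      using l(2) ab unfolding distinct_up_to_scalars_def by metis
    fix i
    assume i: "i < n"
    have "{..<n} - {i} \<subseteq> {j. j < n \<and> a i * b j - a j * b i \<noteq> 0}"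
      using nonparallel[OF i] by auto
    hence "card ({..<n} - {i}) \<le> card {j. j < n \<and> a i * b j - a j * b i \<noteq> 0}"
      by (intro card_mono) auto
    thus "3 \<le> card {j. j < n \<and> a i * b j - a j * b i \<noteq> 0}" using n i by simp
  qed (rule nonconst)
  moreover have "f = (\<Prod>i<n. affine_poly (a i) (b i) 0)"
    using ab by (simp add: f)
  ultimately show thesis using that n by simp
qed

text \<open>Settles the case of two empty products, where f = g = 1.\<close>

lemma affine_change_identity: "affine_change (Finite_Cartesian_Product.mat 1 :: 'a::field^2^2) 0 0 1 = 1"
  by (simp add: affine_change_def Finite_Cartesian_Product.mat_def subst2_1)

theorem corollary6p4:
  fixes f g :: "'a::{alg_closed_field, field_char_0} bpoly"
  assumes "f \<noteq> 0" and "g \<noteq> 0"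
  shows
    "((\<exists>(C :: 'a^2^2) c1 c2. invertible C \<and> g = affine_change C c1 c2 f) \<longrightarrow>
        poisson_isomorphic (rat f) (rat g)) \<and>
     (product_of_distinct_linear_forms f \<and> product_of_distinct_linear_forms g \<and>
        condition_G f \<and> condition_G g \<and>
        poisson_isomorphic (rat f) (rat g) \<longrightarrow>
        (\<exists>(C :: 'a^2^2) c1 c2. invertible C \<and> g = affine_change C c1 c2 f)) \<and>
     (product_of_four_or_more_homogeneous_forms f \<and>
        product_of_four_or_more_homogeneous_forms g \<longrightarrow>
        (poisson_isomorphic (rat f) (rat g) \<longleftrightarrow>
           (\<exists>C :: 'a^2^2. invertible C \<and> g = affine_change C 0 0 f)))"
proof (intro conjI impI; (elim conjE)?)
  assume "\<exists>(C :: 'a^2^2) c1 c2. invertible C \<and> g = affine_change C c1 c2 f"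
  thus "poisson_isomorphic (rat f) (rat g)" using affine_change_poisson_isomorphic by blast
next
  assume "condition_G f" "condition_G g" and iso: "poisson_isomorphic (rat f) (rat g)"
  obtain n a b c where F: "line_arrangement n a b c" "f = (\<Prod>i<n. affine_poly (a i) (b i) (c i))"
    using condition_G_arrangement[OF \<open>condition_G f\<close>] .
  obtain n' a' b' c' where G: "line_arrangement n' a' b' c'"
      "g = (\<Prod>i<n'. affine_poly (a' i) (b' i) (c' i))"
    using condition_G_arrangement[OF \<open>condition_G g\<close>] .
  interpret F: line_arrangement n a b c by (rule F(1))
  interpret G: line_arrangement n' a' b' c' by (rule G(1))
  obtain \<phi> where \<phi>: "poisson_field_iso (rat f) (rat g) \<phi>"
    using iso by (auto simp: poisson_isomorphic_def)
  show "\<exists>(C :: 'a^2^2) c1 c2. invertible C \<and> g = affine_change C c1 c2 f"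
  \<comment> \<open>The empty product is 1, and K{1} is not isomorphic to the Poisson field of a
    nonempty arrangement. Hence both products are empty or neither is.\<close>
  proof (cases "n = 0")
    case True
    hence f: "f = 1" using F(2) by simp
    have "n' = 0"
      using G.not_poisson_isomorphic_1 poisson_field_iso_inv[OF \<phi>] G(2) by (auto simp: f G.form_def)
    hence "g = affine_change (Finite_Cartesian_Product.mat 1) 0 0 f" using G(2) by (simp add: f affine_change_identity)
    moreover have "invertible (Finite_Cartesian_Product.mat 1 :: 'a^2^2)" by (simp add: invertible_det_nz)
    ultimately show ?thesis by blast
  next
    case False
    have "n' \<noteq> 0"
    proof
      assume "n' = 0"
      hence "poisson_field_iso (rat (\<Prod>i<n. F.form i)) (rat 1) \<phi>"
        using \<phi> F(2) G(2) by (simp add: F.form_def)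
      thus False using F.not_poisson_isomorphic_1[of \<phi>] False by simp
    qed
    thus ?thesis using poisson_isomorphic_arrangements[OF F(1) G(1) _ _ F(2) G(2) iso] False by blast
  qed
next
  assume "product_of_four_or_more_homogeneous_forms f" "product_of_four_or_more_homogeneous_forms g"
  obtain n a b where F: "line_arrangement n a b (\<lambda>_. 0)" "n > 0" "f = (\<Prod>i<n. affine_poly (a i) (b i) 0)"
    using four_homogeneous_forms_arrangement[OF \<open>product_of_four_or_more_homogeneous_forms f\<close>] .
  obtain n' a' b' where G: "line_arrangement n' a' b' (\<lambda>_. 0)" "n' > 0"
      "g = (\<Prod>i<n'. affine_poly (a' i) (b' i) 0)"
    using four_homogeneous_forms_arrangement[OF \<open>product_of_four_or_more_homogeneous_forms g\<close>] .
  show "poisson_isomorphic (rat f) (rat g) \<longleftrightarrow>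
      (\<exists>C :: 'a^2^2. invertible C \<and> g = affine_change C 0 0 f)"
  proof
    assume iso: "poisson_isomorphic (rat f) (rat g)"
    \<comment> \<open>All constant terms are 0 here, so the premise of the third property is
      trivially true and the translation vanishes.\<close>
    obtain C :: "'a^2^2" and c1 c2 where "invertible C" "g = affine_change C c1 c2 f"
      "(\<forall>i<n. (0::'a) = 0) \<and> (\<forall>j<n'. (0::'a) = 0) \<longrightarrow> c1 = 0 \<and> c2 = 0"
      by (rule poisson_isomorphic_arrangements[OF F(1) G(1) F(2) G(2) F(3) G(3) iso])
    thus "\<exists>C :: 'a^2^2. invertible C \<and> g = affine_change C 0 0 f" by auto
  next
    assume "\<exists>C :: 'a^2^2. invertible C \<and> g = affine_change C 0 0 f"
    thus "poisson_isomorphic (rat f) (rat g)" using affine_change_poisson_isomorphic by blast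
  qed
qed

end
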